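(* The generating function $F_2(a,b,A,B)=\sum_{i,j\ge 0}A^iB^j\,T_2(a^ib^j)\in\mathbf{C}[a,b][[A,B]]$ is $$F_2(a,b,A,B)=\frac12\operatorname{tr}\Bigl[(I-A\varrho(a'))(I-B\varrho(b'))\Bigr]^{-1}=\frac12\operatorname{tr}M^{-1},$$ where $I$ is the $3\times3$ identity matrix and $M$ is the product $$M=\begin{pmatrix}1+4Aa&-15Ab&0\\0&1-11Aa&-15Ab\\15A&0&1-11Aa\end{pmatrix}\begin{pmatrix}1-22Bb&0&14Bab\\-14Ba&1-22Bb&14Ba^2\\0&-14Ba&1-22Bb\end{pmatrix}.$$
   Context: $q=e^{2\pi i\tau}$; $\mathcal{M}_\kappa(\Gamma)$ is the space of weight $\kappa$ modular forms for $\Gamma$, and $\mathcal{R}_\Gamma=\bigoplus_{\kappa\ge0}\mathcal{M}_\kappa(\Gamma)$. One has $\mathcal{R}=\mathcal{R}_{SL(2,\mathbf{Z})}=\mathbf{C}[a,b]$, a polynomial ring, where $$a(\tau)=-\tfrac13\Bigl(1+240\sum_{n\ge1}\sigma_3(n)q^n\Bigr)\ (\text{weight }4),\qquad b(\tau)=\tfrac{2}{27}\Bigl(1-504\sum_{n\ge1}\sigma_5(n)q^n\Bigr)\ (\text{weight }6).$$ For $f\in\mathcal{M}_\kappa(SL(2,\mathbf{Z}))$, $T_2f(\tau)=\frac12\bigl(2^\kappa f(2\tau)+f(\tau/2)+f((\tau+1)/2)\bigr)$, extended linearly to $\mathcal{R}$. Each $T_2(a^ib^j)$ is written as a polynomial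 in $a,b$; $A,B$ are formal variables. Let $e(\tau)=-\pi^{-2}\wp(1/2;\mathbf{Z}+\mathbf{Z}\tau)=-\frac23\bigl[1+24\sum_{n\ge1}(\sum_{d\mid n,\ d\text{ odd}}d)q^n\bigr]\in\mathcal{M}_2(\Gamma_0(2))$. Then $\mathcal{R}_{\Gamma_0(2)}=\mathcal{R}[e]/(e^3+ae+b)$ is a free $\mathcal{R}$-module with basis $\{1,e,e^2\}$. The map $\varrho:\mathcal{R}_{\Gamma_0(2)}\to M_{3\times3}(\mathcal{R})$ is the regular representation with respect to this basis: the $\mathbf{C}$-algebra homomorphism with $\varrho(a)=aI$, $\varrho(b)=bI$, $\varrho(e)=\begin{pmatrix}0&0&-b\\1&0&-a\\0&1&0\end{pmatrix}$. For $f\in\mathcal{M}_\kappa(SL(2,\mathbf{Z}))$, $f'(\tau)=2^\kappa f(2\tau)$; in particular $a'(\tau)=2^4a(2\tau)$ and $b'(\tau)=2^6b(2\tau)$, which lie in $\mathcal{R}_{\Gamma_0(2)}$. Matrix inverses are taken over $\mathbf{C}[a,b][[A,B]]$. *)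

theory Defs
  imports
    "HOL-Analysis.Analysis"
    "HOL-Computational_Algebra.Computational_Algebra"
begin

definition nome :: "complex \<Rightarrow> complex" where
  "nome \<tau> = exp (2 * of_real pi * \<i> * \<tau>)"

definition sigma :: "nat \<Rightarrow> nat \<Rightarrow> nat" where
  "sigma k n = (\<Sum>d | d dvd n. d ^ k)"

text \<open>
  All functions of \<open>\<tau>\<close> are meaningful on the upper half-plane \<open>Im \<tau> > 0\<close> only; every
  identity between such functions is required there and nowhere else.
\<close>

definition mf_a :: "complex \<Rightarrow> complex" where
  "mf_a \<tau> = - (1/3) * (1 + 240 * (\<Sum>n. of_nat (sigma 3 (Suc n)) * nome \<tau> ^ Suc n))"

definition mf_b :: "complex \<Rightarrow> complex" where
  "mf_b \<tau> = (2/27) * (1 - 504 * (\<Sum>n. of_nat (sigma 5 (Suc n)) * nome \<tau> ^ Suc n))"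

definition lattice :: "complex \<Rightarrow> complex set" where
  "lattice \<tau> = {of_int m + of_int n * \<tau> | m n. True}"

definition wp :: "complex \<Rightarrow> complex \<Rightarrow> complex" where
  "wp \<tau> z = 1 / z\<^sup>2 + (\<Sum>\<^sub>\<infinity>\<omega>\<in>lattice \<tau> - {0}. 1 / (z - \<omega>)\<^sup>2 - 1 / \<omega>\<^sup>2)"

definition mf_e :: "complex \<Rightarrow> complex" where
  "mf_e \<tau> = - wp \<tau> (1/2) / of_real (pi\<^sup>2)"

text \<open>The operation \<open>f \<mapsto> f'\<close> and the Hecke operator \<open>T\<^sub>2\<close> on forms of weight \<open>k\<close>.\<close>

definition level2 :: "nat \<Rightarrow> (complex \<Rightarrow> complex) \<Rightarrow> complex \<Rightarrow> complex" where
  "level2 k f \<tau> = 2 ^ k * f (2 * \<tau>)"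

definition T2 :: "nat \<Rightarrow> (complex \<Rightarrow> complex) \<Rightarrow> complex \<Rightarrow> complex" where
  "T2 k f \<tau> = (1/2) * (2 ^ k * f (2 * \<tau>) + f (\<tau> / 2) + f ((\<tau> + 1) / 2))"

text \<open>
  The polynomial ring \<open>\<complex>[a,b]\<close>: the inner indeterminate is \<open>a\<close>, the outer one is \<open>b\<close>.
  The function \<open>eval_ab\<close> is the map that realises \<open>\<complex>[a,b]\<close> as the ring of modular forms for
  \<open>SL(2,\<int>)\<close>, and \<open>as_poly\<close> writes a modular form as a polynomial in \<open>a\<close> and \<open>b\<close>.
\<close>

type_synonym ring_ab = "complex poly poly"

definition eval_ab :: "ring_ab \<Rightarrow> complex \<Rightarrow> complex" where
  "eval_ab P \<tau> = poly (poly P [:mf_b \<tau>:]) (mf_a \<tau>)"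

definition as_poly :: "(complex \<Rightarrow> complex) \<Rightarrow> ring_ab" where
  "as_poly f = (THE P. \<forall>\<tau>. Im \<tau> > 0 \<longrightarrow> eval_ab P \<tau> = f \<tau>)"

text \<open>
  The regular representation of the ring of modular forms for \<open>\<Gamma>\<^sub>0(2)\<close> over \<open>\<complex>[a,b]\<close> with
  respect to the basis \<open>1, e, e\<^sup>2\<close>: column \<open>j\<close> of \<open>rho f\<close> holds the coordinates of \<open>f\<close> times
  the \<open>j\<close>-th basis element. So \<open>rho\<close> sends \<open>a\<close>, \<open>b\<close> to scalar matrices and \<open>e\<close>, by
  \<open>e\<^sup>3 + a e + b = 0\<close>, to the companion matrix with rows \<open>(0,0,-b)\<close>, \<open>(1,0,-a)\<close>, \<open>(0,1,0)\<close>.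
\<close>

definition basis_e :: "complex \<Rightarrow> complex ^ 3" where
  "basis_e \<tau> = vector [1, mf_e \<tau>, (mf_e \<tau>)\<^sup>2]"

definition rho :: "(complex \<Rightarrow> complex) \<Rightarrow> ring_ab ^ 3 ^ 3" where
  "rho f = (THE N. \<forall>\<tau>. Im \<tau> > 0 \<longrightarrow>
     (\<forall>j. f \<tau> * basis_e \<tau> $ j = (\<Sum>i\<in>UNIV. eval_ab (N $ i $ j) \<tau> * basis_e \<tau> $ i)))"

text \<open>
  The ring \<open>\<complex>[a,b][[A,B]]\<close>: the outer power series variable is \<open>A\<close>, the inner one is \<open>B\<close>, so
  that \<open>fps_nth (fps_nth F i) j\<close> is the coefficient of \<open>A\<^sup>i B\<^sup>j\<close>.
\<close>

type_synonym ring_AB = "ring_ab fps fps"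

definition emb :: "ring_ab \<Rightarrow> ring_AB" where
  "emb P = fps_const (fps_const P)"

definition emb_mat :: "ring_ab ^ 3 ^ 3 \<Rightarrow> ring_AB ^ 3 ^ 3" where
  "emb_mat N = (\<chi> i j. emb (N $ i $ j))"

definition half :: ring_AB where "half = emb [:[:1/2:]:]"
definition va :: ring_AB where "va = emb [:[:0, 1:]:]"
definition vb :: ring_AB where "vb = emb [:0, 1:]"
definition vA :: ring_AB where "vA = fps_X"
definition vB :: ring_AB where "vB = fps_const fps_X"

text \<open>Since \<open>a\<close> and \<open>b\<close> have weights 4 and 6, the monomial \<open>a\<^sup>i b\<^sup>j\<close> has weight \<open>4 i + 6 j\<close>.\<close>

definition F2 :: ring_AB where
  "F2 = Abs_fps (\<lambda>i. Abs_fps (\<lambda>j.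
     as_poly (T2 (4 * i + 6 * j) (\<lambda>\<tau>. mf_a \<tau> ^ i * mf_b \<tau> ^ j))))"

definition M1 :: "ring_AB ^ 3 ^ 3" where
  "M1 = vector
    [vector [1 + 4 * vA * va, - 15 * vA * vb,      0],
     vector [0,               1 - 11 * vA * va,    - 15 * vA * vb],
     vector [15 * vA,         0,                   1 - 11 * vA * va]]"

definition M2 :: "ring_AB ^ 3 ^ 3" where
  "M2 = vector
    [vector [1 - 22 * vB * vb, 0,                  14 * vB * va * vb],
     vector [- 14 * vB * va,   1 - 22 * vB * vb,   14 * vB * va\<^sup>2],
     vector [0,                - 14 * vB * va,     1 - 22 * vB * vb]]"

end

theory Submission
  imports Defs
begin

text \<open>
  Write \<open>x\<^sub>1 = e(\<tau>)\<close>, \<open>x\<^sub>2 = - e(\<tau>/2) / 2\<close> and \<open>x\<^sub>3 = - e((\<tau>+1)/2) / 2\<close>. These are the three roots of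
  \<open>x\<^sup>3 + a x + b\<close>. The three values \<open>2\<^sup>4 a(2\<tau>)\<close>, \<open>a(\<tau>/2)\<close>, \<open>a((\<tau>+1)/2)\<close> that make up \<open>2 T\<^sub>2 a\<close> are the
  values of the one polynomial \<open>- 4 a - 15 x\<^sup>2\<close> at \<open>x\<^sub>1, x\<^sub>2, x\<^sub>3\<close>, and the corresponding values for \<open>b\<close> are
  those of \<open>22 b + 14 a x\<close> (\<open>roots_of_cubic\<close>). Hence \<open>2 T\<^sub>2 (a\<^sup>i b\<^sup>j)\<close> is the sum over the roots of
  \<open>(- 4 a - 15 x\<^sup>2)\<^sup>i (22 b + 14 a x)\<^sup>j\<close>, which is the trace of the matrix that represents multiplication
  by \<open>a'\<^sup>i b'\<^sup>j\<close> (\<open>hecke_monomial\<close>). Summing over \<open>i\<close> and \<open>j\<close> gives a product of two geometric series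
  of matrices (\<open>inverse_product_coeff\<close>). The factors of \<open>M\<close> are the two matrices
  \<open>I - A \<rho>(a')\<close> and \<open>I - B \<rho>(b')\<close> written out.

  The relations between \<open>a\<close>, \<open>b\<close>, \<open>e\<close> and their dilates are identities between the power series \<open>E\<^sub>4\<close>, \<open>E\<^sub>6\<close>
  and \<open>2 E\<^sub>2(q\<^sup>2) - E\<^sub>2(q)\<close>. They are obtained without modularity or dimension formulas. Liouville's
  elementary identity for the solutions of \<open>a x + b y = n\<close> evaluates the convolution sums of \<open>\<sigma>\<^sub>1\<close> and \<open>\<sigma>\<^sub>3\<close>,
  also with a parity condition, and one more relation comes from applying \<open>q d/dq\<close> to
  \<open>5 (2 E\<^sub>2(q\<^sup>2) - E\<^sub>2(q))\<^sup>2 = E\<^sub>4(q) + 4 E\<^sub>4(q\<^sup>2)\<close>. The results are \<open>E2_level2_square\<close>, \<open>E2_level2_E4\<close> and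
  \<open>E2_level2_cube\<close>. That \<open>e = - \<wp>(1/2) / \<pi>\<^sup>2\<close> has the expansion \<open>- (2/3) (2 E\<^sub>2(q\<^sup>2) - E\<^sub>2(q))\<close>
  (\<open>mf_e_eq_phi\<close>) follows by summing the lattice sum row by row with \<open>\<Sum>\<^sub>m 1/(z-m)\<^sup>2 = \<pi>\<^sup>2 / sin\<^sup>2 (\<pi> z)\<close>.

  Both the coefficients of \<open>F\<^sub>2\<close> and the representation \<open>\<rho>\<close> are defined by unique existence, so that
  \<open>1, e, e\<^sup>2\<close> must be shown to be linearly independent over \<open>\<complex>[a,b]\<close> (\<open>basis_independent\<close>). Since
  \<open>b = - e\<^sup>3 - a e\<close>, this reduces to the algebraic independence of \<open>a\<close> and \<open>e\<close>. For that, a polynomial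
  relation between \<open>a(\<tau>)\<close> and \<open>e(\<tau>)\<close> is transported along \<open>\<tau> \<mapsto> \<tau>/(2k\<tau>+1)\<close>. Under this map the lattice
  changes by a scalar, so \<open>e\<close> and \<open>a\<close> are multiplied by \<open>c\<^sup>2\<close> and \<open>c\<^sup>4\<close> with \<open>c = 2k\<tau>+1\<close>. The relation thus
  holds for \<open>(c\<^sup>4 a, c\<^sup>2 e)\<close> with infinitely many \<open>c\<close>, hence with all \<open>c\<close>. It must then be trivial
  because \<open>a/e\<^sup>2\<close> takes infinitely many values.
\<close>

section \<open>Liouville's identity\<close>

text \<open>
  The index set of the convolution \<open>\<Sum>\<^sub>k (\<Sum>\<^sub>a\<^sub>|\<^sub>k f(a)) (\<Sum>\<^sub>b\<^sub>|\<^sub>n\<^sub>-\<^sub>k g(b))\<close>: the quadruple records the two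
  divisors \<open>a\<close>, \<open>b\<close> together with their cofactors \<open>x\<close>, \<open>y\<close>.
\<close>

definition quads :: "nat \<Rightarrow> (nat \<times> nat \<times> nat \<times> nat) set" where
  "quads n = {(a, b, x, y). a > 0 \<and> b > 0 \<and> x > 0 \<and> y > 0 \<and> a * x + b * y = n}"

lemma finite_quads [simp]: "finite (quads n)"
proof (rule finite_subset)
  show "quads n \<subseteq> {..n} \<times> {..n} \<times> {..n} \<times> {..n}"
  proof
    fix t assume "t \<in> quads n"
    then obtain a b x y where t: "t = (a, b, x, y)" and pos: "a > 0" "b > 0" "x > 0" "y > 0"
      and n: "a * x + b * y = n"
      by (auto simp: quads_def)
    have "a \<le> a * x" "x \<le> a * x" "b \<le> b * y" "y \<le> b * y" using pos by simp_all
    with n have "a \<le> n" "x \<le> n" "b \<le> n" "y \<le> n" by linarith+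
    with t show "t \<in> {..n} \<times> {..n} \<times> {..n} \<times> {..n}" by simp
  qed
qed simp

text \<open>
  This is the identity \<open>a x + b (x + k) = (a + b) x + b k\<close>.
\<close>

lemma quads_shear:
  assumes "0 < a" "0 < k"
  shows "(a, b, x, x + k) \<in> quads n \<longleftrightarrow> (a + b, b, x, k) \<in> quads n"
  using assms by (auto simp: quads_def algebra_simps)

lemma quads_sum_shear:
  fixes F :: "nat \<Rightarrow> nat \<Rightarrow> 'a::comm_monoid_add"
  shows "(\<Sum>(a, b, x, y)\<in>{(a, b, x, y). (a, b, x, y) \<in> quads n \<and> x < y}. F a b)
       = (\<Sum>(a, b, x, y)\<in>{(a, b, x, y). (a, b, x, y) \<in> quads n \<and> b < a}. F (a - b) b)"
proof (rule sum.reindex_bij_witness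
        [of _ "\<lambda>(a, b, x, y). (a - b, b, x, x + y)" "\<lambda>(a, b, x, y). (a + b, b, x, y - x)"])
  fix t assume t: "t \<in> {(a, b, x, y). (a, b, x, y) \<in> quads n \<and> x < y}"
  obtain a b x y where [simp]: "t = (a, b, x, y)" by (cases t)
  from t have q: "(a, b, x, y) \<in> quads n" and "x < y" by auto
  then obtain k where y: "y = x + k" "0 < k" using less_imp_add_positive by blast
  have pos: "0 < a" "0 < b" using q by (auto simp: quads_def)
  show "(case case t of (a, b, x, y) \<Rightarrow> (a + b, b, x, y - x) of (a, b, x, y) \<Rightarrow> (a - b, b, x, x + y)) = t"
    using y by simp
  show "(case t of (a, b, x, y) \<Rightarrow> (a + b, b, x, y - x)) \<in> {(a, b, x, y). (a, b, x, y) \<in> quads n \<and> b < a}"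
    using q y pos quads_shear[of a k b x n] by simp
  show "(case case t of (a, b, x, y) \<Rightarrow> (a + b, b, x, y - x) of (a, b, x, y) \<Rightarrow> F (a - b) b)
      = (case t of (a, b, x, y) \<Rightarrow> F a b)" by simp
next
  fix t assume t: "t \<in> {(a, b, x, y). (a, b, x, y) \<in> quads n \<and> b < a}"
  obtain a b x y where [simp]: "t = (a, b, x, y)" by (cases t)
  from t have q: "(a, b, x, y) \<in> quads n" and "b < a" by auto
  then obtain k where a: "a = k + b" "0 < k" using less_imp_add_positive[of b a] by (auto simp: add.commute)
  have pos: "0 < x" "0 < y" using q by (auto simp: quads_def)
  show "(case case t of (a, b, x, y) \<Rightarrow> (a - b, b, x, x + y) of (a, b, x, y) \<Rightarrow> (a + b, b, x, y - x)) = t"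
    using a by simp
  show "(case t of (a, b, x, y) \<Rightarrow> (a - b, b, x, x + y)) \<in> {(a, b, x, y). (a, b, x, y) \<in> quads n \<and> x < y}"
    using q a pos quads_shear[of k y b x n] by simp
qed

lemma quads_sum_flip:
  fixes F :: "nat \<Rightarrow> 'a::comm_monoid_add"
  shows "(\<Sum>(a, b, x, y)\<in>{(a, b, x, y). (a, b, x, y) \<in> quads n \<and> x < y}. F (a + b))
       = (\<Sum>(a, b, x, y)\<in>{(a, b, x, y). (a, b, x, y) \<in> quads n \<and> b < a}. F a)"
  unfolding quads_sum_shear[of "\<lambda>a b. F (a + b)"] by (rule sum.cong) auto

lemma quads_sum_flip':
  fixes F :: "nat \<Rightarrow> 'a::comm_monoid_add"
  shows "(\<Sum>(a, b, x, y)\<in>{(a, b, x, y). (a, b, x, y) \<in> quads n \<and> b < a}. F (a - b))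
       = (\<Sum>(a, b, x, y)\<in>{(a, b, x, y). (a, b, x, y) \<in> quads n \<and> x < y}. F a)"
  unfolding quads_sum_shear[of "\<lambda>a b. F a"] ..

lemma quads_sum_swap:
  fixes F :: "nat \<Rightarrow> nat \<Rightarrow> nat \<Rightarrow> nat \<Rightarrow> 'a::comm_monoid_add"
  shows "(\<Sum>(a, b, x, y)\<in>{(a, b, x, y). (a, b, x, y) \<in> quads n \<and> P a b x y}. F a b x y)
       = (\<Sum>(a, b, x, y)\<in>{(a, b, x, y). (a, b, x, y) \<in> quads n \<and> P b a y x}. F b a y x)"
  by (rule sum.reindex_bij_witness
        [of _ "\<lambda>(a, b, x, y). (b, a, y, x)" "\<lambda>(a, b, x, y). (b, a, y, x)"])
     (auto simp: quads_def algebra_simps)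

text \<open>
  Fix \<open>a\<close> and \<open>y\<close>. The pairs \<open>(x, b)\<close> with \<open>a x + b y = n\<close> form a progression with step \<open>(y, - a)\<close>. If it
  meets the positive quadrant at all, it does so in exactly one pair with \<open>x \<le> y\<close> and in exactly one pair
  with \<open>b \<le> a\<close>. Reducing \<open>b\<close> into \<open>1..a\<close> passes from the former to the latter.
\<close>

lemma quads_sum_reduce:
  fixes F :: "nat \<Rightarrow> 'a::comm_monoid_add"
  shows "(\<Sum>(a, b, x, y)\<in>{(a, b, x, y). (a, b, x, y) \<in> quads n \<and> x \<le> y}. F a)
       = (\<Sum>(a, b, x, y)\<in>{(a, b, x, y). (a, b, x, y) \<in> quads n \<and> b \<le> a}. F a)"
proof -
  \<comment> \<open>Residues are taken in \<open>1..a\<close> rather than \<open>0..<a\<close>, hence the shifts by 1.\<close>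
  have red: "((b - 1) mod a + 1) + a * ((b - 1) div a) = b" if "b > 0" for a b :: nat
    using that by simp
  have shift: "((x + y * k - 1) mod y + 1 = x) \<and> (x + y * k - 1) div y = k"
    if "0 < x" "x \<le> y" for x y k :: nat
  proof -
    have "x + y * k - 1 = (x - 1) + k * y" "x - 1 < y"
      using that by (cases x; simp add: mult.commute)+
    then show ?thesis using that by (simp only: mod_mult_self1 div_mult_self1) auto
  qed
  define f where "f = (\<lambda>(a::nat, b::nat, x::nat, y::nat). (a, (b - 1) mod a + 1, x + y * ((b - 1) div a), y))"
  define g where "g = (\<lambda>(a::nat, b::nat, x::nat, y::nat). (a, b + a * ((x - 1) div y), (x - 1) mod y + 1, y))"
  have fq: "a * (x + y * ((b - 1) div a)) + ((b - 1) mod a + 1) * y = a * x + b * y" if "b > 0" for a b x y :: nat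
  proof -
    have "a * (x + y * ((b - 1) div a)) + ((b - 1) mod a + 1) * y
        = a * x + (((b - 1) mod a + 1) + a * ((b - 1) div a)) * y"
      by (simp only: algebra_simps)
    then show ?thesis by (simp only: red[OF that])
  qed
  have gq: "a * ((x - 1) mod y + 1) + (b + a * ((x - 1) div y)) * y = a * x + b * y" if "x > 0" for a b x y :: nat
  proof -
    have "a * ((x - 1) mod y + 1) + (b + a * ((x - 1) div y)) * y
        = a * (((x - 1) mod y + 1) + y * ((x - 1) div y)) + b * y"
      by (simp only: algebra_simps)
    then show ?thesis by (simp only: red[OF that])
  qed
  show ?thesis
  proof (rule sum.reindex_bij_witness[of _ g f])
    fix t assume t: "t \<in> {(a, b, x, y). (a, b, x, y) \<in> quads n \<and> x \<le> y}"
    obtain a b x y where [simp]: "t = (a, b, x, y)" by (cases t)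
    from t have pos: "a > 0" "b > 0" "x > 0" "y > 0" "x \<le> y" and n: "a * x + b * y = n"
      by (auto simp: quads_def)
    show "g (f t) = t" using red[OF pos(2), of a] shift[OF pos(3,5)] by (simp add: f_def g_def)
    have "(b - 1) mod a < a" using pos by simp
    then show "f t \<in> {(a, b, x, y). (a, b, x, y) \<in> quads n \<and> b \<le> a}"
      using pos fq[OF pos(2), of a x y] n by (simp add: f_def quads_def Suc_le_eq)
    show "(case f t of (a, b, x, y) \<Rightarrow> F a) = (case t of (a, b, x, y) \<Rightarrow> F a)"
      by (simp add: f_def)
  next
    fix t assume t: "t \<in> {(a, b, x, y). (a, b, x, y) \<in> quads n \<and> b \<le> a}"
    obtain a b x y where [simp]: "t = (a, b, x, y)" by (cases t)
    from t have pos: "a > 0" "b > 0" "x > 0" "y > 0" "b \<le> a" and n: "a * x + b * y = n"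
      by (auto simp: quads_def)
    show "f (g t) = t" using red[OF pos(3), of y] shift[OF pos(2,5)] by (simp add: f_def g_def)
    have "(x - 1) mod y < y" using pos by simp
    then show "g t \<in> {(a, b, x, y). (a, b, x, y) \<in> quads n \<and> x \<le> y}"
      using pos gq[OF pos(3), of a y b] n by (simp add: g_def quads_def Suc_le_eq)
  qed
qed

text \<open>
  On the diagonal the equation reads \<open>a (x + y) = n\<close>, so \<open>a\<close> is a divisor and \<open>x\<close> is free in \<open>1..<n div a\<close>.
\<close>

lemma quads_diag_ab:
  fixes F :: "nat \<Rightarrow> 'a::comm_ring_1"
  shows "(\<Sum>(a, b, x, y)\<in>{(a, b, x, y). (a, b, x, y) \<in> quads n \<and> a = b}. F a)
       = (\<Sum>d | d dvd n \<and> 0 < n. of_nat (n div d - 1) * F d)"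
proof -
  have dx: "d * x + d * y = n \<longleftrightarrow> x + y = n div d \<and> d dvd n" if "0 < d" for d x y
  proof -
    have "d * x + d * y = d * (x + y)" by (simp add: algebra_simps)
    then show ?thesis using that by auto
  qed
  have "(\<Sum>(a, b, x, y)\<in>{(a, b, x, y). (a, b, x, y) \<in> quads n \<and> a = b}. F a)
      = (\<Sum>(d, x)\<in>(SIGMA d:{d. d dvd n \<and> 0 < n}. {1..<n div d}). F d)"
  proof (rule sum.reindex_bij_witness
          [of _ "\<lambda>(d, x). (d, d, x, n div d - x)" "\<lambda>(a, b, x, y). (a, x)"], goal_cases)
    case (1 t) then show ?case by (cases t) (auto simp: quads_def dx)
  next
    case (2 t) then show ?case by (cases t) (auto simp: quads_def dx)
  next
    case (3 t) then show ?case by (cases t) auto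
  next
    case (4 t)
    then obtain d x where "t = (d, x)" "d dvd n" "0 < n" "1 \<le> x" "x < n div d" by (cases t) auto
    moreover have "0 < d" using \<open>d dvd n\<close> \<open>0 < n\<close> by (rule dvd_pos_nat[rotated])
    ultimately show ?case by (simp add: quads_def dx)
  next
    case (5 t) then show ?case by (cases t) auto
  qed
  also have "\<dots> = (\<Sum>d | d dvd n \<and> 0 < n. \<Sum>x\<in>{1..<n div d}. F d)"
    by (rule sum.Sigma[symmetric]) auto
  finally show ?thesis by simp
qed

text \<open>
  On the diagonal the equation reads \<open>(a + b) x = n\<close>, so \<open>a + b\<close> is a divisor and \<open>a\<close> is free below it.
\<close>

lemma quads_diag_xy:
  fixes F :: "nat \<Rightarrow> nat \<Rightarrow> 'a::comm_ring_1"
  shows "(\<Sum>(a, b, x, y)\<in>{(a, b, x, y). (a, b, x, y) \<in> quads n \<and> x = y}. F a (a + b))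
       = (\<Sum>d | d dvd n \<and> 0 < n. \<Sum>l\<in>{1..<d}. F l d)"
proof -
  have dx: "a * x + b * x = n \<longleftrightarrow> x = n div (a + b) \<and> (a + b) dvd n" if "0 < a" for a b x
  proof -
    have "a * x + b * x = (a + b) * x" by (simp add: algebra_simps)
    then show ?thesis using that by auto
  qed
  have "(\<Sum>(a, b, x, y)\<in>{(a, b, x, y). (a, b, x, y) \<in> quads n \<and> x = y}. F a (a + b))
      = (\<Sum>(d, l)\<in>(SIGMA d:{d. d dvd n \<and> 0 < n}. {1..<d}). F l d)"
  proof (rule sum.reindex_bij_witness
          [of _ "\<lambda>(d, l). (l, d - l, n div d, n div d)" "\<lambda>(a, b, x, y). (a + b, a)"], goal_cases)
    case (1 t) then show ?case
      by (cases t) (auto simp: quads_def simp flip: distrib_right)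
  next
    case (2 t) then show ?case by (cases t) (auto simp: quads_def intro!: Nat.gr0I simp flip: distrib_right)
  next
    case (3 t) then show ?case by (cases t) auto
  next
    case (4 t)
    then obtain d l where "t = (d, l)" "d dvd n" "0 < n" "1 \<le> l" "l < d" by (cases t) auto
    moreover have "0 < n div d" using \<open>d dvd n\<close> \<open>0 < n\<close> \<open>l < d\<close>
      by (simp add: div_greater_zero_iff dvd_imp_le)
    ultimately show ?case by (simp add: quads_def dx)
  next
    case (5 t) then show ?case by (cases t) auto
  qed
  also have "\<dots> = (\<Sum>d | d dvd n \<and> 0 < n. \<Sum>l\<in>{1..<d}. F l d)"
    by (rule sum.Sigma[symmetric]) auto
  finally show ?thesis .
qed

lemma quads_sum_split:
  fixes F :: "nat \<Rightarrow> nat \<Rightarrow> nat \<Rightarrow> nat \<Rightarrow> 'a::comm_monoid_add"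
  assumes "\<And>a b x y. P a b x y \<longleftrightarrow> Q a b x y \<or> R a b x y"
    and "\<And>a b x y. \<not> (Q a b x y \<and> R a b x y)"
  shows "(\<Sum>(a, b, x, y)\<in>{(a, b, x, y). (a, b, x, y) \<in> quads n \<and> P a b x y}. F a b x y)
       = (\<Sum>(a, b, x, y)\<in>{(a, b, x, y). (a, b, x, y) \<in> quads n \<and> Q a b x y}. F a b x y)
       + (\<Sum>(a, b, x, y)\<in>{(a, b, x, y). (a, b, x, y) \<in> quads n \<and> R a b x y}. F a b x y)"
proof -
  have fin: "finite {(a, b, x, y). (a, b, x, y) \<in> quads n \<and> S a b x y}" for S
    by (rule finite_subset[OF _ finite_quads[of n]]) auto
  show ?thesis
    by (subst sum.union_disjoint[symmetric, OF fin fin]) (use assms in \<open>auto intro!: sum.cong\<close>)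
qed

text \<open>
  Off the diagonals, the shear turns the sum of \<open>F (a - b)\<close> into twice the sum of \<open>F a\<close> over \<open>x < y\<close>, and
  the sum of \<open>F (a + b)\<close> into twice the sum of \<open>F a\<close> over \<open>b < a\<close>. By \<open>quads_sum_reduce\<close> the sums of \<open>F a\<close>
  over \<open>x \<le> y\<close> and over \<open>b \<le> a\<close> agree, so only sums over the diagonals remain, and these are divisor sums.
\<close>

theorem liouville_identity:
  fixes F :: "nat \<Rightarrow> 'a::comm_ring_1"
  assumes F0: "F 0 = 0"
  shows "(\<Sum>(a, b, x, y)\<in>quads n. F (if b \<le> a then a - b else b - a) - F (a + b))
       = (\<Sum>d | d dvd n \<and> 0 < n. 2 * of_nat (n div d - 1) * F d - of_nat (d - 1) * F d
            - 2 * (\<Sum>l\<in>{1..<d}. F l))"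
proof -
  let ?S = "\<lambda>P F. \<Sum>(a, b, x, y)\<in>{(a, b, x, y). (a, b, x, y) \<in> quads n \<and> P a b x y}. F a b x y"
  have all: "(\<Sum>(a, b, x, y)\<in>quads n. G a b x y) = ?S (\<lambda>a b x y. True) G" for G :: "_ \<Rightarrow> _ \<Rightarrow> _ \<Rightarrow> _ \<Rightarrow> 'a"
    by (rule sum.cong) auto
  let ?D = "\<lambda>a b x y. F (if b \<le> a then a - b else b - a)"
  have diff: "(\<Sum>(a, b, x, y)\<in>quads n. ?D a b x y) = 2 * ?S (\<lambda>a b x y. x < y) (\<lambda>a b x y. F a)"
  proof -
    have "(\<Sum>(a, b, x, y)\<in>quads n. ?D a b x y)
        = ?S (\<lambda>a b x y. b \<noteq> a) ?D + ?S (\<lambda>a b x y. b = a) ?D"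
      unfolding all by (rule quads_sum_split) auto
    also have "?S (\<lambda>a b x y. b = a) ?D = 0"
      by (rule sum.neutral) (auto simp: F0)
    also have "?S (\<lambda>a b x y. b \<noteq> a) ?D = ?S (\<lambda>a b x y. b < a) ?D + ?S (\<lambda>a b x y. a < b) ?D"
      by (rule quads_sum_split) auto
    also have "?S (\<lambda>a b x y. a < b) ?D = ?S (\<lambda>a b x y. b < a) (\<lambda>a b x y. ?D b a y x)"
      by (rule quads_sum_swap)
    also have "\<dots> = ?S (\<lambda>a b x y. b < a) (\<lambda>a b x y. F (a - b))"
      by (rule sum.cong) auto
    also have "?S (\<lambda>a b x y. b < a) ?D = ?S (\<lambda>a b x y. b < a) (\<lambda>a b x y. F (a - b))"
      by (rule sum.cong) auto
    finally show ?thesis by (simp only: quads_sum_flip' mult_2 add_0_right)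
  qed
  have plus: "(\<Sum>(a, b, x, y)\<in>quads n. F (a + b))
      = 2 * ?S (\<lambda>a b x y. b < a) (\<lambda>a b x y. F a) + ?S (\<lambda>a b x y. x = y) (\<lambda>a b x y. F (a + b))"
  proof -
    have "(\<Sum>(a, b, x, y)\<in>quads n. F (a + b))
        = ?S (\<lambda>a b x y. x \<noteq> y) (\<lambda>a b x y. F (a + b)) + ?S (\<lambda>a b x y. x = y) (\<lambda>a b x y. F (a + b))"
      unfolding all by (rule quads_sum_split) auto
    also have "?S (\<lambda>a b x y. x \<noteq> y) (\<lambda>a b x y. F (a + b))
        = ?S (\<lambda>a b x y. x < y) (\<lambda>a b x y. F (a + b)) + ?S (\<lambda>a b x y. y < x) (\<lambda>a b x y. F (a + b))"
      by (rule quads_sum_split) auto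
    also have "?S (\<lambda>a b x y. y < x) (\<lambda>a b x y. F (a + b)) = ?S (\<lambda>a b x y. x < y) (\<lambda>a b x y. F (b + a))"
      by (rule quads_sum_swap)
    finally show ?thesis by (simp only: quads_sum_flip mult_2 add.commute[of _ "_::nat"])
  qed
  have le: "?S (\<lambda>a b x y. x < y) (\<lambda>a b x y. F a) + ?S (\<lambda>a b x y. x = y) (\<lambda>a b x y. F a)
      = ?S (\<lambda>a b x y. b < a) (\<lambda>a b x y. F a) + ?S (\<lambda>a b x y. a = b) (\<lambda>a b x y. F a)"
  proof -
    have "?S (\<lambda>a b x y. x \<le> y) (\<lambda>a b x y. F a)
       = ?S (\<lambda>a b x y. x < y) (\<lambda>a b x y. F a) + ?S (\<lambda>a b x y. x = y) (\<lambda>a b x y. F a)"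
      by (rule quads_sum_split) auto
    moreover have "?S (\<lambda>a b x y. b \<le> a) (\<lambda>a b x y. F a)
       = ?S (\<lambda>a b x y. b < a) (\<lambda>a b x y. F a) + ?S (\<lambda>a b x y. a = b) (\<lambda>a b x y. F a)"
      by (rule quads_sum_split) auto
    ultimately show ?thesis by (simp add: quads_sum_reduce)
  qed
  have "(\<Sum>(a, b, x, y)\<in>quads n. ?D a b x y - F (a + b))
      = (\<Sum>(a, b, x, y)\<in>quads n. ?D a b x y) - (\<Sum>(a, b, x, y)\<in>quads n. F (a + b))"
    by (simp add: sum_subtractf case_prod_unfold)
  also have "\<dots> = 2 * ?S (\<lambda>a b x y. a = b) (\<lambda>a b x y. F a)
      - 2 * ?S (\<lambda>a b x y. x = y) (\<lambda>a b x y. F a) - ?S (\<lambda>a b x y. x = y) (\<lambda>a b x y. F (a + b))"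
    using arg_cong[OF le, of "\<lambda>t. 2 * t"] unfolding diff plus by (simp add: algebra_simps)
  also have "\<dots> = (\<Sum>d | d dvd n \<and> 0 < n. 2 * of_nat (n div d - 1) * F d - of_nat (d - 1) * F d
            - 2 * (\<Sum>l\<in>{1..<d}. F l))"
    using quads_diag_ab[of F n] quads_diag_xy[of "\<lambda>l d. F l" n] quads_diag_xy[of "\<lambda>l d. F d" n]
    by (simp add: sum_subtractf sum_distrib_left mult.assoc)
  finally show ?thesis .
qed

section \<open>Convolution sums of divisor functions\<close>

text \<open>
  The expansion of \<open>\<Sum>\<^sub>d g(d) q\<^sup>d / (1 - q\<^sup>d)\<close>. Every \<open>d\<close> divides \<open>0\<close>, so the condition \<open>0 < n\<close> is what makes
  the constant term vanish.
\<close>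

definition lambert :: "(nat \<Rightarrow> complex) \<Rightarrow> complex fps" where
  "lambert g = Abs_fps (\<lambda>n. \<Sum>d | d dvd n \<and> 0 < n. g d)"

lemma lambert_add: "lambert (\<lambda>d. f d + g d) = lambert f + lambert g"
  by (rule fps_ext) (simp add: lambert_def sum.distrib)

lemma lambert_cmult: "lambert (\<lambda>d. c * f d) = fps_const c * lambert f"
  by (rule fps_ext) (simp add: lambert_def sum_distrib_left)

lemma lambert_mult_nth:
  "fps_nth (lambert f * lambert g) n = (\<Sum>(a, b, x, y)\<in>quads n. f a * g b)"
proof -
  let ?D = "\<lambda>i. {d. d dvd i \<and> 0 < i}"
  have "fps_nth (lambert f * lambert g) n = (\<Sum>i=0..n. \<Sum>p\<in>?D i \<times> ?D (n - i). f (fst p) * g (snd p))"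
    by (simp add: fps_mult_nth lambert_def sum_product sum.cartesian_product case_prod_unfold)
  also have "\<dots> = (\<Sum>(i, p)\<in>(SIGMA i:{0..n}. ?D i \<times> ?D (n - i)). f (fst p) * g (snd p))"
    by (rule sum.Sigma) auto
  also have "\<dots> = (\<Sum>(a, b, x, y)\<in>quads n. f a * g b)"
  proof (rule sum.reindex_bij_witness
          [of _ "\<lambda>(a, b, x, y). (a * x, a, b)" "\<lambda>(i, a, b). (a, b, i div a, (n - i) div b)"], goal_cases)
    case (1 t) then show ?case by (cases t) auto
  next
    case (2 t)
    then obtain i a b where "t = (i, a, b)" "i \<le> n" "a dvd i" "0 < i" "b dvd n - i" "0 < n - i"
      by (cases t) auto
    moreover from this have "0 < a" "0 < b" by (meson dvd_pos_nat)+
    moreover from calculation have "0 < i div a" "0 < (n - i) div b"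
      by (simp_all add: div_greater_zero_iff dvd_imp_le del: zero_less_diff)
    ultimately show ?case by (simp add: quads_def)
  next
    case (3 t) then show ?case by (cases t) (auto simp: quads_def)
  next
    case (4 t) then show ?case by (cases t) (auto simp: quads_def)
  next
    case (5 t) then show ?case by (cases t) auto
  qed
  finally show ?thesis .
qed

text \<open>
  The derivation \<open>q d/dq\<close>.
\<close>

definition euler :: "complex fps \<Rightarrow> complex fps" where
  "euler f = fps_X * fps_deriv f"

lemma euler_nth [simp]: "fps_nth (euler f) n = of_nat n * fps_nth f n"
  by (cases n) (auto simp: euler_def)

text \<open>
  If \<open>F d\<close> has a factor \<open>d\<close>, the term \<open>(n/d) F d\<close> of Liouville's identity becomes \<open>n H d\<close>, which is a
  coefficient of \<open>q d/dq\<close> of a Lambert series. The right-hand side is then linear in Lambert series.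
\<close>

lemma liouville_lambert:
  assumes "\<And>d. F d = of_nat d * H d"
    and "\<And>d. (of_nat d + 1) * F d + 2 * (\<Sum>l\<in>{1..<d}. F l) = G d"
  shows "(\<Sum>(a, b, x, y)\<in>quads n. F (if b \<le> a then a - b else b - a) - F (a + b))
       = fps_nth (2 * euler (lambert H) - lambert G) n"
proof -
  have "(\<Sum>(a, b, x, y)\<in>quads n. F (if b \<le> a then a - b else b - a) - F (a + b))
      = (\<Sum>d | d dvd n \<and> 0 < n. 2 * of_nat (n div d - 1) * F d - of_nat (d - 1) * F d
            - 2 * (\<Sum>l\<in>{1..<d}. F l))"
    by (rule liouville_identity) (simp add: assms(1))
  also have "\<dots> = (\<Sum>d | d dvd n \<and> 0 < n. 2 * of_nat n * H d - G d)"
  proof (rule sum.cong, rule refl, clarify)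
    fix d assume d: "d dvd n" "0 < n"
    then obtain k where n: "n = d * k" by blast
    with d have pos: "0 < d" "0 < k" by auto
    have "2 * of_nat (n div d - 1) * F d - of_nat (d - 1) * F d - 2 * (\<Sum>l\<in>{1..<d}. F l)
        = 2 * of_nat n * H d - ((of_nat d + 1) * F d + 2 * (\<Sum>l\<in>{1..<d}. F l))"
      using pos by (simp add: n of_nat_diff assms(1) algebra_simps)
    then show "2 * of_nat (n div d - 1) * F d - of_nat (d - 1) * F d - 2 * (\<Sum>l\<in>{1..<d}. F l)
        = 2 * of_nat n * H d - G d"
      by (simp only: assms(2))
  qed
  also have "\<dots> = fps_nth (2 * euler (lambert H) - lambert G) n"
    by (simp add: lambert_def sum_subtractf sum_distrib_left fps_numeral_fps_const mult.assoc)
  finally show ?thesis .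
qed

abbreviation ev :: "nat \<Rightarrow> complex" where "ev d \<equiv> (if even d then 1 else 0)"

lemma sum_powers2:
  "(\<Sum>l\<in>{1..<d}. of_nat l ^ 2 :: complex) = of_nat d ^ 3 / 3 - of_nat d ^ 2 / 2 + of_nat d / 6"
proof (induction d)
  case (Suc d)
  have step: "(\<Sum>l\<in>{1..<Suc d}. of_nat l ^ 2 :: complex) = (\<Sum>l\<in>{1..<d}. of_nat l ^ 2) + of_nat d ^ 2"
    by (cases "d = 0") auto
  show ?case unfolding step Suc.IH by (cases "even d") (simp_all, simp_all add: field_simps eval_nat_numeral)
qed simp

lemma sum_powers4:
  "(\<Sum>l\<in>{1..<d}. of_nat l ^ 4 :: complex) = of_nat d ^ 5 / 5 - of_nat d ^ 4 / 2 + of_nat d ^ 3 / 3 - of_nat d / 30"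
proof (induction d)
  case (Suc d)
  have step: "(\<Sum>l\<in>{1..<Suc d}. of_nat l ^ 4 :: complex) = (\<Sum>l\<in>{1..<d}. of_nat l ^ 4) + of_nat d ^ 4"
    by (cases "d = 0") auto
  show ?case unfolding step Suc.IH by (cases "even d") (simp_all, simp_all add: field_simps eval_nat_numeral)
qed simp

lemma sum_even_powers2:
  "(\<Sum>l\<in>{1..<d}. ev l * of_nat l ^ 2 :: complex) = of_nat d ^ 3 / 6 - of_nat d / 6 + ev d * (of_nat d / 2 - of_nat d ^ 2 / 2)"
proof (induction d)
  case (Suc d)
  have step: "(\<Sum>l\<in>{1..<Suc d}. ev l * of_nat l ^ 2 :: complex) = (\<Sum>l\<in>{1..<d}. ev l * of_nat l ^ 2) + ev d * of_nat d ^ 2"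
    by (cases "d = 0") auto
  show ?case unfolding step Suc.IH by (cases "even d") (simp_all, simp_all add: field_simps eval_nat_numeral)
qed simp

lemma sum_even_powers4:
  "(\<Sum>l\<in>{1..<d}. ev l * of_nat l ^ 4 :: complex) = of_nat d ^ 5 / 10 - of_nat d ^ 3 / 3 + 7 * of_nat d / 30
       + ev d * (of_nat d ^ 3 - of_nat d ^ 4 / 2 - of_nat d / 2)"
proof (induction d)
  case (Suc d)
  have step: "(\<Sum>l\<in>{1..<Suc d}. ev l * of_nat l ^ 4 :: complex) = (\<Sum>l\<in>{1..<d}. ev l * of_nat l ^ 4) + ev d * of_nat d ^ 4"
    by (cases "d = 0") auto
  show ?case unfolding step Suc.IH by (cases "even d") (simp_all, simp_all add: field_simps eval_nat_numeral)
qed simp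

definition sigma_fps :: "nat \<Rightarrow> complex fps" where "sigma_fps k = lambert (\<lambda>d. of_nat d ^ k)"
text \<open>
  The same series in \<open>q\<^sup>2\<close>; it carries the contribution of the even divisors.
\<close>

definition sigma_fps2 :: "nat \<Rightarrow> complex fps" where "sigma_fps2 k = sigma_fps k oo fps_X ^ 2"

lemma lambert_even: "lambert (\<lambda>d. ev d * of_nat d ^ k) = fps_const (2 ^ k) * sigma_fps2 k"
proof (rule fps_ext)
  fix n
  have "fps_nth (lambert (\<lambda>d. ev d * of_nat d ^ k)) n = (\<Sum>d | d dvd n \<and> 0 < n \<and> even d. of_nat d ^ k)"
    unfolding lambert_def fps_nth_Abs_fps by (rule sum.mono_neutral_cong_right) (auto)
  also have "\<dots> = (if even n then \<Sum>d | d dvd n div 2 \<and> 0 < n div 2. of_nat (2 * d) ^ k else 0)"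
  proof (cases "even n")
    case True
    then obtain m where n: "n = 2 * m" by blast
    show ?thesis unfolding n
      by (simp, rule sum.reindex_bij_witness[of _ "\<lambda>d. 2 * d" "\<lambda>d. d div 2"]) (auto elim!: evenE)
  next
    case False
    then have "{d. d dvd n \<and> 0 < n \<and> even d} = {}" using dvd_trans by blast
    with False show ?thesis by (simp only: if_False sum.empty)
  qed
  also have "\<dots> = fps_nth (fps_const (2 ^ k) * sigma_fps2 k) n"
    by (simp add: sigma_fps2_def sigma_fps_def lambert_def fps_nth_compose_X_power sum_distrib_left power_mult_distrib)
  finally show "fps_nth (lambert (\<lambda>d. ev d * of_nat d ^ k)) n = fps_nth (fps_const (2 ^ k) * sigma_fps2 k) n" .
qed

text \<open>
  For \<open>F x = x\<^sup>2\<close> the difference \<open>F (a - b) - F (a + b)\<close> is \<open>- 4 a b\<close>.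
\<close>

lemma convolution_1_1: "12 * (sigma_fps 1 * sigma_fps 1) = 5 * sigma_fps 3 + sigma_fps 1 - 6 * euler (sigma_fps 1)"
proof -
  have G: "(of_nat d + 1) * of_nat d ^ 2 + 2 * (\<Sum>l\<in>{1..<d}. of_nat l ^ 2)
      = (5/3 * of_nat d ^ 3 + 1/3 * of_nat d ^ 1 :: complex)" for d
    unfolding sum_powers2 by (simp add: field_simps eval_nat_numeral)
  have "fps_nth (- 4 * (sigma_fps 1 * sigma_fps 1)) n
     = fps_nth (2 * euler (sigma_fps 1) - lambert (\<lambda>d. 5/3 * of_nat d ^ 3 + 1/3 * of_nat d ^ 1)) n" for n
  proof -
    have "fps_nth (2 * euler (sigma_fps 1) - lambert (\<lambda>d. 5/3 * of_nat d ^ 3 + 1/3 * of_nat d ^ 1)) n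
        = (\<Sum>(a, b, x, y)\<in>quads n. of_nat (if b \<le> a then a - b else b - a) ^ 2 - of_nat (a + b) ^ 2)"
      unfolding sigma_fps_def by (rule liouville_lambert[OF _ G, symmetric]) (simp add: power2_eq_square)
    also have "\<dots> = (\<Sum>(a, b, x, y)\<in>quads n. - 4 * (of_nat a ^ 1 * of_nat b ^ 1))"
      by (rule sum.cong) (auto simp: of_nat_diff algebra_simps power2_eq_square)
    also have "\<dots> = - 4 * fps_nth (sigma_fps 1 * sigma_fps 1) n"
      unfolding sigma_fps_def lambert_mult_nth by (simp add: sum_distrib_left case_prod_unfold sum_negf)
    finally show ?thesis by (simp add: power2_eq_square fps_numeral_fps_const)
  qed
  then have "- 4 * (sigma_fps 1 * sigma_fps 1) = 2 * euler (sigma_fps 1) - (fps_const (5/3) * sigma_fps 3 + fps_const (1/3) * sigma_fps 1)"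
    unfolding fps_eq_iff lambert_add lambert_cmult sigma_fps_def by blast
  from arg_cong[OF this, of "\<lambda>t. - 3 * t"] show ?thesis
    by (simp add: fps_eq_iff fps_numeral_fps_const algebra_simps)
qed

text \<open>
  For \<open>F x = x\<^sup>4\<close> the difference \<open>F (a - b) - F (a + b)\<close> is \<open>- 8 (a b\<^sup>3 + a\<^sup>3 b)\<close>.
\<close>

lemma convolution_1_3: "240 * (sigma_fps 1 * sigma_fps 3) = 21 * sigma_fps 5 + 10 * sigma_fps 3 - sigma_fps 1 - 30 * euler (sigma_fps 3)"
proof -
  let ?G = "\<lambda>d. 7/5 * of_nat d ^ 5 + (2/3 * of_nat d ^ 3 + - 1/15 * of_nat d ^ 1) :: complex"
  have G: "(of_nat d + 1) * of_nat d ^ 4 + 2 * (\<Sum>l\<in>{1..<d}. of_nat l ^ 4) = ?G d" for d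
    unfolding sum_powers4 by (simp add: field_simps eval_nat_numeral)
  have "fps_nth (- 16 * (sigma_fps 1 * sigma_fps 3)) n = fps_nth (2 * euler (sigma_fps 3) - lambert ?G) n" for n
  proof -
    have "fps_nth (2 * euler (sigma_fps 3) - lambert ?G) n
        = (\<Sum>(a, b, x, y)\<in>quads n. of_nat (if b \<le> a then a - b else b - a) ^ 4 - of_nat (a + b) ^ 4)"
      unfolding sigma_fps_def by (rule liouville_lambert[OF _ G, symmetric]) (simp add: eval_nat_numeral)
    also have "\<dots> = (\<Sum>(a, b, x, y)\<in>quads n. - 8 * (of_nat a ^ 1 * of_nat b ^ 3) + - 8 * (of_nat a ^ 3 * of_nat b ^ 1))"
      by (rule sum.cong) (auto simp: of_nat_diff algebra_simps eval_nat_numeral)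
    also have "\<dots> = - 8 * fps_nth (sigma_fps 1 * sigma_fps 3) n + - 8 * fps_nth (sigma_fps 3 * sigma_fps 1) n"
      unfolding sigma_fps_def lambert_mult_nth by (simp only: sum_distrib_left case_prod_unfold sum.distrib)
    finally show ?thesis by (simp add: mult.commute[of "sigma_fps 3"] fps_numeral_fps_const)
  qed
  then have "- 16 * (sigma_fps 1 * sigma_fps 3) = 2 * euler (sigma_fps 3)
      - (fps_const (7/5) * sigma_fps 5 + (fps_const (2/3) * sigma_fps 3 + fps_const (- 1/15) * sigma_fps 1))"
    unfolding fps_eq_iff lambert_add lambert_cmult sigma_fps_def by blast
  from arg_cong[OF this, of "\<lambda>t. - 15 * t"] show ?thesis
    by (simp add: fps_eq_iff fps_numeral_fps_const algebra_simps)
qed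

text \<open>
  Both \<open>a + b\<close> and \<open>a - b\<close> are even if and only if \<open>a\<close> and \<open>b\<close> have equal parity. Written as a polynomial in
  the two parity indicators, this condition splits the convolution into products of Lambert series.
\<close>

lemma even_add_ev: "ev (a + b) = 1 - ev a - ev b + 2 * (ev a * ev b)"
  "ev (if b \<le> a then a - b else b - a) = 1 - ev a - ev b + 2 * (ev a * ev b)"
  by auto

lemma fps_nth_const_mult: "fps_nth (f * (fps_const c * g)) n = c * fps_nth (f * g) (n :: nat)" for c :: complex
  by (simp add: mult.left_commute[of f])

text \<open>
  Liouville's identity for \<open>x\<^sup>2\<close> restricted to even \<open>x\<close>.
\<close>

lemma convolution_even_1_1:
  "12 * (sigma_fps 1 ^ 2 - 4 * (sigma_fps 1 * sigma_fps2 1) + 8 * sigma_fps2 1 ^ 2)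
     = sigma_fps 3 - sigma_fps 1 + 24 * sigma_fps2 3 + 6 * sigma_fps2 1 - 12 * euler (sigma_fps2 1)"
proof -
  let ?G = "\<lambda>d. 1/3 * of_nat d ^ 3 + (- 1/3 * of_nat d ^ 1
      + (ev d * of_nat d ^ 3 + ev d * of_nat d ^ 1)) :: complex"
  let ?o1 = "\<lambda>d. of_nat d ^ 1 :: complex" and ?e1 = "\<lambda>d. ev d * of_nat d ^ 1 :: complex"
  have G: "(of_nat d + 1) * (ev d * of_nat d ^ 2) + 2 * (\<Sum>l\<in>{1..<d}. ev l * of_nat l ^ 2) = ?G d" for d
    unfolding sum_even_powers2 by (cases "even d") (simp_all add: field_simps eval_nat_numeral)
  have "fps_nth (2 * euler (lambert ?e1) - lambert ?G) n
      = - 4 * fps_nth (lambert ?o1 * lambert ?o1) n + (4 * fps_nth (lambert ?o1 * lambert ?e1) n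
         + (4 * fps_nth (lambert ?e1 * lambert ?o1) n + - 8 * fps_nth (lambert ?e1 * lambert ?e1) n))" (is "?L n = ?R n") for n
  proof -
    have "fps_nth (2 * euler (lambert ?e1) - lambert ?G) n
        = (\<Sum>(a, b, x, y)\<in>quads n. ev (if b \<le> a then a - b else b - a) * of_nat (if b \<le> a then a - b else b - a) ^ 2
            - ev (a + b) * of_nat (a + b) ^ 2)"
      by (rule liouville_lambert[OF _ G, symmetric]) (simp add: power2_eq_square)
    also have "\<dots> = (\<Sum>(a, b, x, y)\<in>quads n. - 4 * (?o1 a * ?o1 b)
         + (4 * (?o1 a * ?e1 b) + (4 * (?e1 a * ?o1 b) + - 8 * (?e1 a * ?e1 b))))"
      unfolding even_add_ev
      by (rule sum.cong) (auto simp: of_nat_diff algebra_simps power2_eq_square)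
    finally show ?thesis
      unfolding lambert_mult_nth by (simp only: sum_distrib_left case_prod_unfold sum.distrib)
  qed
  then have eq: "- 3 * ?L n = - 3 * ?R n" for n by simp
  show ?thesis
  proof (rule fps_ext, goal_cases)
    case (1 n)
    show ?case
      using eq[of n] unfolding lambert_add lambert_cmult lambert_even
      unfolding sigma_fps_def[symmetric] fps_numeral_fps_const
      by (simp add: fps_nth_const_mult mult.assoc power2_eq_square, simp add: algebra_simps)
  qed
qed

text \<open>
  Liouville's identity for \<open>x\<^sup>4\<close> restricted to even \<open>x\<close>.
\<close>

lemma convolution_even_1_3:
  "240 * (sigma_fps 3 * sigma_fps 1 - 8 * (sigma_fps2 3 * sigma_fps 1) - 2 * (sigma_fps 3 * sigma_fps2 1) + 32 * (sigma_fps2 3 * sigma_fps2 1))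
     = 3 * sigma_fps 5 - 10 * sigma_fps 3 + 7 * sigma_fps 1 + 480 * sigma_fps2 5 + 240 * sigma_fps2 3 - 30 * sigma_fps2 1
       - 240 * euler (sigma_fps2 3)"
proof -
  let ?G = "\<lambda>d. 1/5 * of_nat d ^ 5 + (- 2/3 * of_nat d ^ 3 + (7/15 * of_nat d ^ 1
      + (ev d * of_nat d ^ 5 + (2 * (ev d * of_nat d ^ 3) + - 1 * (ev d * of_nat d ^ 1))))) :: complex"
  let ?o1 = "\<lambda>d. of_nat d ^ 1 :: complex" and ?e1 = "\<lambda>d. ev d * of_nat d ^ 1 :: complex"
  let ?o3 = "\<lambda>d. of_nat d ^ 3 :: complex" and ?e3 = "\<lambda>d. ev d * of_nat d ^ 3 :: complex"
  have G: "(of_nat d + 1) * (ev d * of_nat d ^ 4) + 2 * (\<Sum>l\<in>{1..<d}. ev l * of_nat l ^ 4) = ?G d" for d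
    unfolding sum_even_powers4 by (cases "even d") (simp_all add: field_simps eval_nat_numeral)
  have "fps_nth (2 * euler (lambert ?e3) - lambert ?G) n
      = - 8 * fps_nth (lambert ?o1 * lambert ?o3) n + (8 * fps_nth (lambert ?o1 * lambert ?e3) n
         + (8 * fps_nth (lambert ?e1 * lambert ?o3) n + (- 16 * fps_nth (lambert ?e1 * lambert ?e3) n
      + (- 8 * fps_nth (lambert ?o3 * lambert ?o1) n + (8 * fps_nth (lambert ?o3 * lambert ?e1) n
         + (8 * fps_nth (lambert ?e3 * lambert ?o1) n + - 16 * fps_nth (lambert ?e3 * lambert ?e1) n))))))" (is "?L n = ?R n") for n
  proof -
    have "fps_nth (2 * euler (lambert ?e3) - lambert ?G) n
        = (\<Sum>(a, b, x, y)\<in>quads n. ev (if b \<le> a then a - b else b - a) * of_nat (if b \<le> a then a - b else b - a) ^ 4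
            - ev (a + b) * of_nat (a + b) ^ 4)"
      by (rule liouville_lambert[OF _ G, symmetric]) (simp add: power4_eq_xxxx power3_eq_cube)
    also have "\<dots> = (\<Sum>(a, b, x, y)\<in>quads n. - 8 * (?o1 a * ?o3 b)
         + (8 * (?o1 a * ?e3 b) + (8 * (?e1 a * ?o3 b) + (- 16 * (?e1 a * ?e3 b)
         + (- 8 * (?o3 a * ?o1 b)
         + (8 * (?o3 a * ?e1 b) + (8 * (?e3 a * ?o1 b) + - 16 * (?e3 a * ?e1 b))))))))"
      unfolding even_add_ev
      by (rule sum.cong) (auto simp: of_nat_diff algebra_simps power4_eq_xxxx power3_eq_cube)
    finally show ?thesis
      unfolding lambert_mult_nth by (simp only: sum_distrib_left case_prod_unfold sum.distrib)
  qed
  then have eq: "- 15 * ?L n = - 15 * ?R n" for n by simp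
  show ?thesis
  proof (rule fps_ext, goal_cases)
    case (1 n)
    show ?case
      using eq[of n] unfolding lambert_add lambert_cmult lambert_even
      unfolding sigma_fps_def[symmetric] fps_numeral_fps_const
      by (simp add: fps_nth_const_mult mult.assoc power2_eq_square, simp add: algebra_simps)
  qed
qed

lemma euler_compose: "euler (f oo fps_X ^ 2) = 2 * (euler f oo fps_X ^ 2)"
  by (rule fps_ext) (auto simp: fps_nth_compose_X_power fps_numeral_fps_const elim!: evenE)

lemma euler_mult: "euler (f * g) = euler f * g + f * euler g"
  by (simp add: euler_def algebra_simps)

lemma compose_X2:
  "(f + g :: complex fps) oo fps_X ^ 2 = (f oo fps_X ^ 2) + (g oo fps_X ^ 2)"
  "(f - g :: complex fps) oo fps_X ^ 2 = (f oo fps_X ^ 2) - (g oo fps_X ^ 2)"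
  "(f * g :: complex fps) oo fps_X ^ 2 = (f oo fps_X ^ 2) * (g oo fps_X ^ 2)"
  "(numeral k :: complex fps) oo fps_X ^ 2 = numeral k"
  by (auto simp: fps_compose_add_distrib fps_compose_sub_distrib fps_compose_mult_distrib fps_numeral_fps_const)

lemma convolution2_1_1: "12 * (sigma_fps2 1 * sigma_fps2 1) = 5 * sigma_fps2 3 + sigma_fps2 1 - 3 * euler (sigma_fps2 1)"
  using arg_cong[OF convolution_1_1, of "\<lambda>t. t oo fps_X ^ 2"]
  by (simp add: compose_X2 euler_compose sigma_fps2_def)

lemma convolution2_1_3: "240 * (sigma_fps2 1 * sigma_fps2 3) = 21 * sigma_fps2 5 + 10 * sigma_fps2 3 - sigma_fps2 1 - 15 * euler (sigma_fps2 3)"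
  using arg_cong[OF convolution_1_3, of "\<lambda>t. t oo fps_X ^ 2"]
  by (simp add: compose_X2 euler_compose sigma_fps2_def)

section \<open>Relations between the Eisenstein series of levels one and two\<close>

definition E2 :: "complex fps" where "E2 = 1 - 24 * sigma_fps 1"
definition E4 :: "complex fps" where "E4 = 1 + 240 * sigma_fps 3"
definition E6 :: "complex fps" where "E6 = 1 - 504 * sigma_fps 5"
text \<open>
  The Eisenstein series of weight 2 for \<open>\<Gamma>\<^sub>0(2)\<close>, equal to \<open>- (3/2) e\<close> as a \<open>q\<close>-series.
\<close>

definition E2_level2 :: "complex fps" where "E2_level2 = 2 * (E2 oo fps_X ^ 2) - E2"

lemma E_oo_X2:
  "E2 oo fps_X ^ 2 = 1 - 24 * sigma_fps2 1" "E4 oo fps_X ^ 2 = 1 + 240 * sigma_fps2 3" "E6 oo fps_X ^ 2 = 1 - 504 * sigma_fps2 5"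
  by (simp_all add: E2_def E4_def E6_def compose_X2 sigma_fps2_def)

lemma euler_simps:
  "euler (f + g) = euler f + euler g" "euler (f - g) = euler f - euler g"
  "euler (numeral k * f) = numeral k * euler f" "euler 1 = 0" "euler (numeral k) = 0"
  by (simp_all add: euler_def algebra_simps fps_numeral_fps_const)

text \<open>
  Ramanujan's differential equation for \<open>E\<^sub>2\<close> is a rewriting of the convolution of \<open>\<sigma>\<^sub>1\<close> with itself, and
  the one for \<open>E\<^sub>4\<close> below is a rewriting of the convolution of \<open>\<sigma>\<^sub>1\<close> with \<open>\<sigma>\<^sub>3\<close>.
\<close>

lemma ramanujan_E2: "12 * euler E2 = E2 * E2 - E4"
proof -
  have "12 * euler E2 - (E2 * E2 - E4) = - 48 * (12 * (sigma_fps 1 * sigma_fps 1) - (5 * sigma_fps 3 + sigma_fps 1 - 6 * euler (sigma_fps 1)))"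
    unfolding E2_def E4_def euler_simps by (simp add: algebra_simps)
  then show ?thesis unfolding convolution_1_1 by simp
qed

lemma ramanujan_E4: "3 * euler E4 = E2 * E4 - E6"
proof -
  have "3 * euler E4 - (E2 * E4 - E6)
      = 24 * (240 * (sigma_fps 1 * sigma_fps 3) - (21 * sigma_fps 5 + 10 * sigma_fps 3 - sigma_fps 1 - 30 * euler (sigma_fps 3)))"
    unfolding E2_def E4_def E6_def euler_simps by (simp add: algebra_simps)
  then show ?thesis unfolding convolution_1_3 by simp
qed

text \<open>
  The square contains the convolutions of \<open>\<sigma>\<^sub>1\<close> with \<open>\<sigma>\<^sub>1(n/2)\<close> and with itself in exactly the combination that
  is known from the restricted identity and from the identity in \<open>q\<^sup>2\<close>. The derivatives cancel.
\<close>

lemma E2_level2_square: "5 * (E2_level2 * E2_level2) = E4 + 4 * (E4 oo fps_X ^ 2)"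
proof -
  have "5 * (E2_level2 * E2_level2) - (E4 + 4 * (E4 oo fps_X ^ 2))
     = 240 * (12 * (sigma_fps 1 ^ 2 - 4 * (sigma_fps 1 * sigma_fps2 1) + 8 * sigma_fps2 1 ^ 2)
     - (sigma_fps 3 - sigma_fps 1 + 24 * sigma_fps2 3 + 6 * sigma_fps2 1 - 12 * euler (sigma_fps2 1)))
       - 960 * (12 * (sigma_fps2 1 * sigma_fps2 1) - (5 * sigma_fps2 3 + sigma_fps2 1 - 3 * euler (sigma_fps2 1)))"
    unfolding E2_level2_def unfolding E_oo_X2 unfolding E4_def E2_def by (simp add: algebra_simps power2_eq_square)
  then show ?thesis unfolding convolution_even_1_1 convolution2_1_1 by simp
qed

text \<open>
  The identity for \<open>x\<^sup>4\<close> on even \<open>x\<close> determines only one combination of the two products on the left. A second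
  one is found by differentiating \<open>E2_level2_square\<close>.
\<close>

lemma E2_level2_E4_first: "7 * (E2_level2 * E4 - 8 * (E2_level2 * (E4 oo fps_X ^ 2))) = - (48 * (E6 oo fps_X ^ 2) + E6)"
proof -
  have "7 * (E2_level2 * E4 - 8 * (E2_level2 * (E4 oo fps_X ^ 2))) + (48 * (E6 oo fps_X ^ 2) + E6)
    = 168 * (240 * (sigma_fps 3 * sigma_fps 1 - 8 * (sigma_fps2 3 * sigma_fps 1) - 2 * (sigma_fps 3 * sigma_fps2 1) + 32 * (sigma_fps2 3 * sigma_fps2 1))
     - (3 * sigma_fps 5 - 10 * sigma_fps 3 + 7 * sigma_fps 1 + 480 * sigma_fps2 5 + 240 * sigma_fps2 3 - 30 * sigma_fps2 1
       - 240 * euler (sigma_fps2 3)))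
     - 2688 * (240 * (sigma_fps2 1 * sigma_fps2 3) - (21 * sigma_fps2 5 + 10 * sigma_fps2 3 - sigma_fps2 1 - 15 * euler (sigma_fps2 3)))"
    unfolding E2_level2_def unfolding E_oo_X2 unfolding E4_def E2_def E6_def by (simp add: algebra_simps)
  then show ?thesis unfolding convolution_even_1_3 convolution2_1_3
    by (simp only: eq_neg_iff_add_eq_0 diff_self mult_zero_right)
qed

text \<open>
  Apply \<open>q d/dq\<close> to \<open>E2_level2_square\<close> and replace the derivatives by Ramanujan's equations. The terms that
  still contain \<open>E\<^sub>2\<close> are \<open>E\<^sub>2\<close> times a multiple of \<open>E2_level2_square\<close> and drop out.
\<close>

lemma E2_level2_E4_second: "3 * (E2_level2 * E4 - 4 * (E2_level2 * (E4 oo fps_X ^ 2))) = - (E6 + 8 * (E6 oo fps_X ^ 2))"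
proof -
  define P P2 Q Q2 R R2 where defs: "P = E2" "P2 = E2 oo fps_X ^ 2" "Q = E4" "Q2 = E4 oo fps_X ^ 2"
    "R = E6" "R2 = E6 oo fps_X ^ 2"
  have dP: "12 * euler P = P * P - Q" and dQ: "3 * euler Q = P * Q - R"
    unfolding defs by (rule ramanujan_E2 ramanujan_E4)+
  have dP2: "6 * euler P2 = P2 * P2 - Q2"
    using arg_cong[OF ramanujan_E2, of "\<lambda>t. t oo fps_X ^ 2"]
    by (simp add: compose_X2 euler_compose defs)
  have dQ2: "3 * euler Q2 = 2 * (P2 * Q2 - R2)"
    using arg_cong[OF ramanujan_E4, of "\<lambda>t. 2 * (t oo fps_X ^ 2)"]
    by (simp add: compose_X2 euler_compose defs algebra_simps)
  have S: "E2_level2 = 2 * P2 - P" by (simp add: E2_level2_def defs)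
  have sq: "5 * (E2_level2 * E2_level2) = Q + 4 * Q2" by (simp add: E2_level2_square defs)
  have "10 * (E2_level2 * euler E2_level2) = euler Q + 4 * euler Q2"
    using arg_cong[OF sq, of euler] by (simp add: euler_simps euler_mult algebra_simps)
  then have "10 * (E2_level2 * (12 * euler E2_level2)) = 4 * (3 * euler Q) + 16 * (3 * euler Q2)"
    by algebra
  moreover have "12 * euler E2_level2 = 4 * (6 * euler P2) - 12 * euler P"
    unfolding S euler_simps by (simp add: algebra_simps)
  ultimately have *: "10 * (E2_level2 * (4 * (P2 * P2 - Q2) - (P * P - Q))) = 4 * (P * Q - R) + 16 * (2 * (P2 * Q2 - R2))"
    by (simp only: dP dQ dP2 dQ2)
  \<comment> \<open>On the left, \<open>4 P2\<^sup>2 - P\<^sup>2 = E2_level2 (E2_level2 + 2 P)\<close>, and \<open>sq\<close> replaces the square of \<open>E2_level2\<close>.\<close>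
  have "4 * (3 * (E2_level2 * Q - 4 * (E2_level2 * Q2))) = 4 * (- (R + 8 * R2))"
    using * sq S by algebra
  then show ?thesis unfolding defs by (rule mult_left_cancel[THEN iffD1, rotated]) simp
qed

theorem E2_level2_E4: "32 * (E6 oo fps_X ^ 2) = 11 * E6 + 21 * (E2_level2 * E4)"
  using E2_level2_E4_first E2_level2_E4_second by algebra

text \<open>
  Multiplying \<open>E2_level2_square\<close> by \<open>E2_level2\<close> reduces the cube to the two products evaluated above.
\<close>

theorem E2_level2_cube: "4 * E2_level2 ^ 3 = 3 * (E2_level2 * E4) + E6"
proof -
  have "10 * (4 * E2_level2 ^ 3) = 10 * (3 * (E2_level2 * E4) + E6)"
    using E2_level2_E4_first E2_level2_E4_second E2_level2_square by algebra
  then show ?thesis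
    by (rule mult_left_cancel[THEN iffD1, rotated]) simp
qed

section \<open>The roots of the cubic\<close>

text \<open>
  The series \<open>\<Sum>\<^sub>n n\<^sup>k q\<^sup>n\<close> is obtained from the geometric series by applying \<open>q d/dq\<close> \<open>k\<close> times.
\<close>

lemma conv_radius_power_nat: "conv_radius (\<lambda>n. of_nat n ^ k :: complex) \<ge> 1"
proof -
  have nth: "fps_nth ((euler ^^ k) (Abs_fps (\<lambda>_. 1))) n = of_nat n ^ k" for n
    by (induction k) auto
  have "fps_conv_radius ((euler ^^ k) (Abs_fps (\<lambda>_. 1))) \<ge> 1"
  proof (induction k)
    case 0
    show ?case unfolding fps_conv_radius_def
      by (rule conv_radius_geI_ex') (simp add: summable_geometric)
  next
    case (Suc k)
    let ?f = "(euler ^^ k) (Abs_fps (\<lambda>_. 1))"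
    have "1 \<le> min (fps_conv_radius (fps_X :: complex fps)) (fps_conv_radius (fps_deriv ?f))"
      using Suc fps_conv_radius_deriv[of ?f] by (auto intro: order_trans)
    also have "\<dots> \<le> fps_conv_radius (euler ?f)"
      unfolding euler_def by (rule fps_conv_radius_mult)
    finally show ?case by simp
  qed
  then show ?thesis by (simp add: fps_conv_radius_def nth)
qed

text \<open>
  A number \<open>n\<close> has at most \<open>n\<close> divisors, all at most \<open>n\<close>, so the \<open>n\<close>-th coefficient is bounded by \<open>n\<^sup>k\<^sup>+\<^sup>1\<close>.
\<close>

lemma conv_radius_lambert:
  assumes "\<And>d. norm (g d) \<le> of_nat d ^ k"
  shows "fps_conv_radius (lambert g) \<ge> 1"
proof -
  have "norm (fps_nth (lambert g) n) \<le> norm (of_nat n ^ Suc k :: complex)" for n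
  proof (cases "n = 0")
    case False
    have "norm (fps_nth (lambert g) n) \<le> (\<Sum>d | d dvd n \<and> 0 < n. real n ^ k)"
      unfolding lambert_def fps_nth_Abs_fps
      by (intro sum_norm_le order.trans[OF assms] power_mono) (auto simp: dvd_imp_le)
    also have "\<dots> = real (card {d. d dvd n \<and> 0 < n}) * real n ^ k" by simp
    also have "\<dots> \<le> real (card {1..n}) * real n ^ k"
      by (intro mult_right_mono of_nat_mono card_mono)
         (auto simp: dvd_imp_le Suc_le_eq intro: dvd_pos_nat)
    finally show ?thesis by (simp add: norm_power norm_mult)
  qed (simp add: lambert_def)
  note le = this
  show ?thesis unfolding fps_conv_radius_def
  proof (rule conv_radius_geI_ex')
    fix r :: real assume r: "0 < r" "ereal r < 1"
    show "summable (\<lambda>n. fps_nth (lambert g) n * of_real r ^ n)"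
    proof (rule summable_comparison_test')
      show "summable (\<lambda>n. norm (of_nat n ^ Suc k * of_real r ^ n :: complex))"
        using r conv_radius_power_nat[of "Suc k"]
        by (intro abs_summable_in_conv_radius less_le_trans[OF _ conv_radius_power_nat]) simp
      show "norm (fps_nth (lambert g) n * of_real r ^ n) \<le> norm (of_nat n ^ Suc k * of_real r ^ n :: complex)" for n
        unfolding norm_mult by (intro mult_right_mono le norm_ge_zero)
    qed
  qed
qed

lemma eval_fps_sums:
  assumes "fps_conv_radius f \<ge> 1" "norm z < 1"
  shows "(\<lambda>n. fps_nth f n * z ^ n) sums eval_fps f (z :: complex)"
  unfolding eval_fps_def
  using assms by (intro summable_sums summable_fps) (auto intro: less_le_trans[of _ 1])

lemma dilate_sums:
  assumes "(\<lambda>n. fps_nth f n * (z ^ 2) ^ n) sums (s :: complex)"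
  shows "(\<lambda>n. fps_nth (f oo fps_X ^ 2) n * z ^ n) sums s"
proof -
  have "(\<lambda>n. fps_nth (f oo fps_X ^ 2) (2 * n) * z ^ (2 * n)) sums s"
    using assms by (simp add: fps_nth_compose_X_power power_mult)
  moreover have "strict_mono (\<lambda>n::nat. 2 * n)" by (auto simp: strict_mono_def)
  moreover have "fps_nth (f oo fps_X ^ 2) n * z ^ n = 0" if "n \<notin> range (\<lambda>n. 2 * n)" for n
    using that by (auto simp: fps_nth_compose_X_power elim!: evenE)
  ultimately show ?thesis using sums_mono_reindex[of "\<lambda>n. 2 * n" "\<lambda>n. fps_nth (f oo fps_X ^ 2) n * z ^ n" s]
    by blast
qed

lemma conv_radius_dilate:
  assumes "fps_conv_radius (f :: complex fps) \<ge> 1"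
  shows "fps_conv_radius (f oo fps_X ^ 2) \<ge> 1"
  unfolding fps_conv_radius_def
proof (rule conv_radius_geI_ex')
  fix r :: real assume r: "0 < r" "ereal r < 1"
  then have "norm ((of_real r :: complex) ^ 2) < 1" by (simp add: norm_power power_less_one_iff)
  from dilate_sums[OF eval_fps_sums[OF assms this]]
  show "summable (\<lambda>n. fps_nth (f oo fps_X ^ 2) n * of_real r ^ n)" by (rule sums_summable)
qed

lemma eval_fps_dilate:
  assumes "fps_conv_radius f \<ge> 1" "norm z < 1"
  shows "eval_fps (f oo fps_X ^ 2) z = eval_fps f ((z :: complex) ^ 2)"
proof -
  have "norm (z ^ 2) < 1" using assms by (simp add: norm_power power_less_one_iff)
  from sums_unique2[OF eval_fps_sums[OF conv_radius_dilate[OF assms(1)] assms(2)]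
      dilate_sums[OF eval_fps_sums[OF assms(1) this]]]
  show ?thesis .
qed

text \<open>
  The power-series form of \<open>f(\<tau>) \<mapsto> (f(\<tau>/2) + f((\<tau>+1)/2)) / 2\<close>: the two arguments have nomes \<open>z\<close> and \<open>- z\<close>,
  the two square roots of the nome of \<open>\<tau>\<close>.
\<close>

definition even_part :: "complex fps \<Rightarrow> complex fps" where
  "even_part f = Abs_fps (\<lambda>n. fps_nth f (2 * n))"

lemma eval_fps_even_part:
  assumes "fps_conv_radius f \<ge> 1" "fps_conv_radius (even_part f) \<ge> 1" "norm z < 1"
  shows "eval_fps f z + eval_fps f (- z) = 2 * eval_fps (even_part f) (z ^ 2)"
proof -
  have "norm (z ^ 2) < 1" using assms by (simp add: norm_power power_less_one_iff)
  from dilate_sums[OF eval_fps_sums[OF assms(2) this]]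
  have "(\<lambda>n. 2 * (fps_nth (even_part f oo fps_X ^ 2) n * z ^ n)) sums (2 * eval_fps (even_part f) (z ^ 2))"
    by (rule sums_mult)
  moreover have "2 * (fps_nth (even_part f oo fps_X ^ 2) n * z ^ n)
      = fps_nth f n * z ^ n + fps_nth f n * (- z) ^ n" for n
    by (auto simp: fps_nth_compose_X_power even_part_def elim!: evenE oddE)
  moreover have "(\<lambda>n. fps_nth f n * z ^ n + fps_nth f n * (- z) ^ n) sums (eval_fps f z + eval_fps f (- z))"
    using assms by (intro sums_add eval_fps_sums) auto
  ultimately show ?thesis by (simp add: sums_unique2)
qed

lemma even_part_simps:
  "even_part (f + g) = even_part f + even_part g" "even_part (f - g) = even_part f - even_part g"
  "even_part (numeral k * f) = numeral k * even_part f" "even_part 1 = 1"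
  "even_part (f oo fps_X ^ 2) = f"
  by (rule fps_ext; simp add: even_part_def fps_numeral_fps_const fps_nth_compose_X_power)+

lemma sigma_fps_odd: "lambert (\<lambda>d. (1 - ev d) * of_nat d ^ k) = sigma_fps k - fps_const (2 ^ k) * sigma_fps2 k"
proof -
  have "lambert (\<lambda>d. (1 - ev d) * of_nat d ^ k) = lambert (\<lambda>d. of_nat d ^ k) - lambert (\<lambda>d. ev d * of_nat d ^ k)"
    by (rule fps_ext) (simp add: lambert_def sum_subtractf algebra_simps)
  then show ?thesis by (simp add: lambert_even sigma_fps_def)
qed

text \<open>
  The numbers \<open>n\<close> and \<open>2 n\<close> have the same odd divisors.
\<close>

lemma even_part_odd: "even_part (lambert (\<lambda>d. (1 - ev d) * g d)) = lambert (\<lambda>d. (1 - ev d) * g d)"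
proof (rule fps_ext)
  fix n
  have "(\<Sum>d | d dvd 2 * n \<and> 0 < 2 * n. (1 - ev d) * g d) = (\<Sum>d | d dvd n \<and> 0 < n. (1 - ev d) * g d)"
    by (rule sum.mono_neutral_right) (auto dest: coprime_dvd_mult_right_iff[THEN iffD1, rotated])
  then show "fps_nth (even_part (lambert (\<lambda>d. (1 - ev d) * g d))) n = fps_nth (lambert (\<lambda>d. (1 - ev d) * g d)) n"
    by (simp add: even_part_def lambert_def)
qed

lemma E2_level2_odd: "E2_level2 = 1 + 24 * lambert (\<lambda>d. (1 - ev d) * of_nat d ^ 1)"
  unfolding sigma_fps_odd E2_level2_def unfolding E_oo_X2 unfolding E2_def
  by (simp add: algebra_simps numeral_fps_const)

lemma even_part_E2_level2: "even_part E2_level2 = E2_level2"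
  unfolding E2_level2_odd even_part_simps even_part_odd ..

text \<open>
  This says that \<open>E\<^sub>4\<close> is an eigenform of \<open>T\<^sub>2\<close>. In divisor sums it amounts to
  \<open>\<sigma>\<^sub>3(2 n) + 8 \<sigma>\<^sub>3(n/2) = 9 \<sigma>\<^sub>3(n)\<close>, which is obtained by treating the odd and the even divisors separately.
\<close>

lemma even_part_E4: "even_part E4 = 9 * E4 - 8 * (E4 oo fps_X ^ 2)"
proof -
  have 8: "fps_const (2 ^ 3) = (8 :: complex fps)" by (simp add: numeral_fps_const)
  have L: "sigma_fps 3 = lambert (\<lambda>d. (1 - ev d) * of_nat d ^ 3) + 8 * sigma_fps2 3"
    unfolding sigma_fps_odd 8 by simp
  have "even_part (sigma_fps 3) = (sigma_fps 3 - 8 * sigma_fps2 3) + 8 * sigma_fps 3"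
    by (subst L, simp only: even_part_simps even_part_odd, simp only: sigma_fps_odd sigma_fps2_def even_part_simps 8)
  then show ?thesis unfolding E_oo_X2 unfolding E4_def even_part_simps by simp
qed


lemma norm_nome_less_1: "Im \<tau> > 0 \<Longrightarrow> norm (nome \<tau>) < 1"
  by (simp add: nome_def)

lemma nome_double: "nome (2 * \<tau>) = nome \<tau> ^ 2"
  unfolding nome_def exp_of_nat_mult[symmetric] by (simp add: algebra_simps)

lemma nome_half_shift: "nome ((\<tau> + 1) / 2) = - nome (\<tau> / 2)"
  by (simp add: nome_def algebra_simps add_divide_distrib exp_add)

lemma nome_shift: "nome (\<tau> + 1) = nome \<tau>"
  by (simp add: nome_def algebra_simps exp_add)

lemma conv_radius_combine:
  assumes "fps_conv_radius (f :: complex fps) \<ge> 1" "fps_conv_radius g \<ge> 1"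
  shows "fps_conv_radius (f + g) \<ge> 1" "fps_conv_radius (f - g) \<ge> 1" "fps_conv_radius (f * g) \<ge> 1"
  using assms fps_conv_radius_add[of f g] fps_conv_radius_diff[of f g] fps_conv_radius_mult[of f g]
  by (meson min.boundedI order_trans)+

lemma conv_radius_numeral: "fps_conv_radius (numeral k :: complex fps) \<ge> 1" "fps_conv_radius (1 :: complex fps) \<ge> 1"
  by simp_all

lemma conv_radius_sigma_fps: "fps_conv_radius (sigma_fps k) \<ge> 1"
  unfolding sigma_fps_def by (rule conv_radius_lambert[of _ k]) (simp add: norm_power)

lemma conv_radius_E:
  "fps_conv_radius E4 \<ge> 1" "fps_conv_radius E6 \<ge> 1" "fps_conv_radius E2_level2 \<ge> 1"
  unfolding E2_level2_def E2_def E4_def E6_def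
  by (intro conv_radius_combine conv_radius_dilate conv_radius_numeral conv_radius_sigma_fps)+

lemma eval_combine:
  assumes "fps_conv_radius (f :: complex fps) \<ge> 1" "fps_conv_radius g \<ge> 1" "norm z < 1"
  shows "eval_fps (f + g) z = eval_fps f z + eval_fps g z"
    and "eval_fps (f - g) z = eval_fps f z - eval_fps g z"
    and "eval_fps (f * g) z = eval_fps f z * eval_fps g z"
proof -
  have "ereal (norm z) < fps_conv_radius f" "ereal (norm z) < fps_conv_radius g"
    using assms by (auto intro: less_le_trans[of _ 1])
  then show "eval_fps (f + g) z = eval_fps f z + eval_fps g z"
    "eval_fps (f - g) z = eval_fps f z - eval_fps g z" "eval_fps (f * g) z = eval_fps f z * eval_fps g z"
    by (simp_all add: eval_fps_add eval_fps_diff eval_fps_mult)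
qed

lemma eval_sigma_fps:
  assumes "norm z < 1"
  shows "eval_fps (sigma_fps k) z = (\<Sum>n. of_nat (sigma k (Suc n)) * z ^ Suc n)"
proof -
  have "(\<lambda>n. fps_nth (sigma_fps k) n * z ^ n) sums eval_fps (sigma_fps k) z"
    by (rule eval_fps_sums[OF conv_radius_sigma_fps assms])
  then have "(\<lambda>n. fps_nth (sigma_fps k) (Suc n) * z ^ Suc n) sums eval_fps (sigma_fps k) z"
    by (subst sums_Suc_iff) (simp add: sigma_fps_def lambert_def)
  then show ?thesis
    by (simp add: sums_iff sigma_fps_def lambert_def sigma_def)
qed

lemma mf_a_eval: "Im \<tau> > 0 \<Longrightarrow> mf_a \<tau> = - (1/3) * eval_fps E4 (nome \<tau>)"
  unfolding E4_def
  by (simp add: mf_a_def eval_sigma_fps eval_combine norm_nome_less_1 conv_radius_combine conv_radius_numeral conv_radius_sigma_fps)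

lemma mf_b_eval: "Im \<tau> > 0 \<Longrightarrow> mf_b \<tau> = (2/27) * eval_fps E6 (nome \<tau>)"
  unfolding E6_def
  by (simp add: mf_b_def eval_sigma_fps eval_combine norm_nome_less_1 conv_radius_combine conv_radius_numeral conv_radius_sigma_fps)

lemma nome_periodic_forms: "mf_a (\<tau> + 1) = mf_a \<tau>" "mf_b (\<tau> + 1) = mf_b \<tau>"
  by (simp_all add: mf_a_def mf_b_def nome_shift)

text \<open>
  The \<open>q\<close>-expansion of \<open>e\<close>; the equality with the lattice sum is \<open>mf_e_eq_phi\<close>.
\<close>

definition phi :: "complex \<Rightarrow> complex" where
  "phi \<tau> = - (2/3) * eval_fps E2_level2 (nome \<tau>)"

lemma level2_relations:
  assumes "Im \<tau> > 0"
  shows a_double: "16 * mf_a (2 * \<tau>) = - 4 * mf_a \<tau> - 15 * phi \<tau> ^ 2"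
    and b_double: "64 * mf_b (2 * \<tau>) = 22 * mf_b \<tau> + 14 * mf_a \<tau> * phi \<tau>"
    and cubic: "phi \<tau> ^ 3 + mf_a \<tau> * phi \<tau> + mf_b \<tau> = 0"
proof -
  let ?q = "nome \<tau>"
  note q = norm_nome_less_1[OF assms]
  note [simp] = eval_combine[OF _ _ q] conv_radius_E conv_radius_combine(3) conv_radius_numeral
    conv_radius_dilate eval_fps_dilate[OF _ q]
  have sq: "5 * (eval_fps E2_level2 ?q * eval_fps E2_level2 ?q) = eval_fps E4 ?q + 4 * eval_fps E4 (?q ^ 2)"
    using arg_cong[OF E2_level2_square, of "\<lambda>f. eval_fps f ?q"] by simp
  have se: "32 * eval_fps E6 (?q ^ 2) = 11 * eval_fps E6 ?q + 21 * (eval_fps E2_level2 ?q * eval_fps E4 ?q)"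
    using arg_cong[OF E2_level2_E4, of "\<lambda>f. eval_fps f ?q"] by simp
  have cb: "4 * eval_fps E2_level2 ?q ^ 3 = 3 * (eval_fps E2_level2 ?q * eval_fps E4 ?q) + eval_fps E6 ?q"
    using arg_cong[OF E2_level2_cube, of "\<lambda>f. eval_fps f ?q"] by (simp add: power3_eq_cube)
  have vals: "mf_a \<tau> = - (1/3) * eval_fps E4 ?q" "mf_b \<tau> = (2/27) * eval_fps E6 ?q"
    "mf_a (2 * \<tau>) = - (1/3) * eval_fps E4 (?q ^ 2)" "mf_b (2 * \<tau>) = (2/27) * eval_fps E6 (?q ^ 2)"
    using assms mf_a_eval[of "2 * \<tau>"] mf_b_eval[of "2 * \<tau>"] by (simp_all add: mf_a_eval mf_b_eval nome_double)
  show "16 * mf_a (2 * \<tau>) = - 4 * mf_a \<tau> - 15 * phi \<tau> ^ 2"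
    unfolding vals phi_def using arg_cong[OF sq, of "\<lambda>t. 4/3 * t"] by (simp add: power2_eq_square algebra_simps)
  show "64 * mf_b (2 * \<tau>) = 22 * mf_b \<tau> + 14 * mf_a \<tau> * phi \<tau>"
    unfolding vals phi_def using arg_cong[OF se, of "\<lambda>t. 4/27 * t"] by (simp add: algebra_simps)
  show "phi \<tau> ^ 3 + mf_a \<tau> * phi \<tau> + mf_b \<tau> = 0"
    unfolding vals phi_def using arg_cong[OF cb, of "\<lambda>t. 2/27 * t"] by (simp add: algebra_simps power3_eq_cube)
qed

lemma phi_half_sum:
  assumes "Im \<tau> > 0"
  shows "phi (\<tau> / 2) + phi ((\<tau> + 1) / 2) = 2 * phi \<tau>"
proof -
  have q: "norm (nome (\<tau> / 2)) < 1" by (rule norm_nome_less_1) (use assms in simp)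
  have "nome \<tau> = nome (\<tau> / 2) ^ 2" using nome_double[of "\<tau> / 2"] by simp
  then have "eval_fps E2_level2 (nome (\<tau> / 2)) + eval_fps E2_level2 (- nome (\<tau> / 2)) = 2 * eval_fps E2_level2 (nome \<tau>)"
    using eval_fps_even_part[of E2_level2, OF _ _ q] by (simp add: even_part_E2_level2 conv_radius_E)
  from arg_cong[OF this, of "\<lambda>t. - (2/3) * t"] show ?thesis
    unfolding phi_def nome_half_shift by (simp add: algebra_simps)
qed

text \<open>
  The function \<open>a\<close> is an eigenform of \<open>T\<^sub>2\<close>. This supplies the sum of the squares of the roots below.
\<close>

lemma a_hecke:
  assumes "Im \<tau> > 0"
  shows "mf_a (\<tau> / 2) + mf_a ((\<tau> + 1) / 2) = 18 * mf_a \<tau> - 16 * mf_a (2 * \<tau>)"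
proof -
  have q: "norm (nome (\<tau> / 2)) < 1" by (rule norm_nome_less_1) (use assms in simp)
  have q': "norm (nome \<tau>) < 1" by (rule norm_nome_less_1) (use assms in simp)
  have e: "nome \<tau> = nome (\<tau> / 2) ^ 2" using nome_double[of "\<tau> / 2"] by simp
  have r: "fps_conv_radius (9 * E4 - 8 * (E4 oo fps_X ^ 2)) \<ge> 1"
    by (intro conv_radius_combine conv_radius_E conv_radius_dilate conv_radius_numeral)
  have "eval_fps E4 (nome (\<tau> / 2)) + eval_fps E4 (nome ((\<tau> + 1) / 2))
      = 2 * eval_fps (9 * E4 - 8 * (E4 oo fps_X ^ 2)) (nome \<tau>)"
    using eval_fps_even_part[of E4, OF _ _ q] r by (simp add: nome_half_shift even_part_E4 conv_radius_E e)
  also have "\<dots> = 18 * eval_fps E4 (nome \<tau>) - 16 * eval_fps E4 (nome (2 * \<tau>))"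
    using q' by (simp add: eval_combine conv_radius_combine conv_radius_E conv_radius_dilate
       conv_radius_numeral eval_fps_dilate nome_double)
  finally have h: "eval_fps E4 (nome (\<tau> / 2)) + eval_fps E4 (nome ((\<tau> + 1) / 2))
      = 18 * eval_fps E4 (nome \<tau>) - 16 * eval_fps E4 (nome (2 * \<tau>))" .
  have vals: "mf_a \<tau> = - (1/3) * eval_fps E4 (nome \<tau>)"
    "mf_a (\<tau> / 2) = - (1/3) * eval_fps E4 (nome (\<tau> / 2))"
    "mf_a ((\<tau> + 1) / 2) = - (1/3) * eval_fps E4 (nome ((\<tau> + 1) / 2))"
    "mf_a (2 * \<tau>) = - (1/3) * eval_fps E4 (nome (2 * \<tau>))"
    by (rule mf_a_eval, use assms in simp)+
  show ?thesis
    using arg_cong[OF h, of "\<lambda>t. - (1/3) * t"] unfolding vals by (simp add: algebra_simps)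
qed

text \<open>
  The relations for \<open>e\<close> at the point \<open>\<tau>/2\<close> express \<open>a(\<tau>)\<close>, \<open>b(\<tau>)\<close> through \<open>a(\<tau>/2)\<close>, \<open>b(\<tau>/2)\<close>, \<open>e(\<tau>/2)\<close>. Solved
  for the forms at \<open>\<tau>/2\<close>, they give the same polynomials in \<open>x\<^sub>2 = - e(\<tau>/2) / 2\<close> that \<open>2\<^sup>4 a(2\<tau>)\<close> and
  \<open>2\<^sup>6 b(2\<tau>)\<close> are in \<open>x\<^sub>1\<close>, and the cubic equation for \<open>x\<^sub>2\<close>. The point \<open>(\<tau>+1)/2\<close> is treated in the same way.
  Having three solutions of the cubic would not suffice if they coincided. The first two power sums, in contrast,
  equal the traces of \<open>\<rho>(e)\<close> and \<open>\<rho>(e\<^sup>2)\<close> in all cases.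
\<close>

theorem roots_of_cubic:
  fixes \<tau> :: complex
  assumes "Im \<tau> > 0"
  defines "x1 \<equiv> phi \<tau>" and "x2 \<equiv> - phi (\<tau> / 2) / 2" and "x3 \<equiv> - phi ((\<tau> + 1) / 2) / 2"
  shows "x1 + x2 + x3 = 0" "x1 ^ 2 + x2 ^ 2 + x3 ^ 2 = - 2 * mf_a \<tau>"
    and "x \<in> {x1, x2, x3} \<Longrightarrow> x ^ 3 + mf_a \<tau> * x + mf_b \<tau> = 0"
    and "mf_a (\<tau> / 2) = - 4 * mf_a \<tau> - 15 * x2 ^ 2" "mf_b (\<tau> / 2) = 22 * mf_b \<tau> + 14 * mf_a \<tau> * x2"
    and "mf_a ((\<tau> + 1) / 2) = - 4 * mf_a \<tau> - 15 * x3 ^ 2" "mf_b ((\<tau> + 1) / 2) = 22 * mf_b \<tau> + 14 * mf_a \<tau> * x3"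
proof -
  have half: "mf_a \<sigma> = - 4 * mf_a (2 * \<sigma>) - 15 * (- phi \<sigma> / 2) ^ 2
      \<and> mf_b \<sigma> = 22 * mf_b (2 * \<sigma>) + 14 * mf_a (2 * \<sigma>) * (- phi \<sigma> / 2)
      \<and> (- phi \<sigma> / 2) ^ 3 + mf_a (2 * \<sigma>) * (- phi \<sigma> / 2) + mf_b (2 * \<sigma>) = 0" if "Im \<sigma> > 0" for \<sigma>
  proof -
    \<comment> \<open>Eliminate \<open>a(\<sigma>)\<close> first, then \<open>b(\<sigma>)\<close> through the cubic; the remaining relation is 64 times the cubic for \<open>y\<close>.\<close>
    define y where "y = - phi \<sigma> / 2"
    have y: "phi \<sigma> = - 2 * y" by (simp add: y_def)
    note rel = level2_relations[OF that, unfolded y]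
    have a: "mf_a \<sigma> = - 4 * mf_a (2 * \<sigma>) - 15 * y ^ 2"
    proof -
      have "4 * mf_a \<sigma> = 4 * (- 4 * mf_a (2 * \<sigma>) - 15 * y ^ 2)" using rel(1) by algebra
      then show ?thesis by (rule mult_left_cancel[THEN iffD1, rotated]) simp
    qed
    have b: "mf_b \<sigma> = - 22 * y ^ 3 - 8 * mf_a (2 * \<sigma>) * y"
      using rel(3) unfolding a by algebra
    have c: "64 * (y ^ 3 + mf_a (2 * \<sigma>) * y + mf_b (2 * \<sigma>)) = 0"
      using rel(2) unfolding a b by (simp add: power2_eq_square power3_eq_cube algebra_simps)
    then have c: "y ^ 3 + mf_a (2 * \<sigma>) * y + mf_b (2 * \<sigma>) = 0"
      by (simp only: mult_eq_0_iff) simp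
    have "mf_b \<sigma> = 22 * mf_b (2 * \<sigma>) + 14 * mf_a (2 * \<sigma>) * y"
      using b c by algebra
    with a c show ?thesis by (simp add: y_def)
  qed
  have h2: "Im (\<tau> / 2) > 0" and h3: "Im ((\<tau> + 1) / 2) > 0" using assms by simp_all
  have d: "2 * ((\<tau> + 1) / 2) = \<tau> + 1" "2 * (\<tau> / 2) = \<tau>" by simp_all
  note r2 = half[OF h2, unfolded d] and r3 = half[OF h3, unfolded d nome_periodic_forms]
  show a2: "mf_a (\<tau> / 2) = - 4 * mf_a \<tau> - 15 * x2 ^ 2" and "mf_b (\<tau> / 2) = 22 * mf_b \<tau> + 14 * mf_a \<tau> * x2"
    using r2 by (auto simp: x2_def)
  show a3: "mf_a ((\<tau> + 1) / 2) = - 4 * mf_a \<tau> - 15 * x3 ^ 2" and "mf_b ((\<tau> + 1) / 2) = 22 * mf_b \<tau> + 14 * mf_a \<tau> * x3"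
    using r3 by (auto simp: x3_def)
  have "phi \<tau> = phi (\<tau> / 2) / 2 + phi ((\<tau> + 1) / 2) / 2"
    unfolding add_divide_distrib[symmetric] phi_half_sum[OF assms(1)] by simp
  then show "x1 + x2 + x3 = 0" by (simp add: x1_def x2_def x3_def)
  show "x ^ 3 + mf_a \<tau> * x + mf_b \<tau> = 0" if "x \<in> {x1, x2, x3}"
    using that r2 r3 cubic[OF assms(1)] by (auto simp: x1_def x2_def x3_def)
  have "15 * (x1 ^ 2 + x2 ^ 2 + x3 ^ 2) = 15 * (- 2 * mf_a \<tau>)"
    using a_hecke[OF assms(1)] a_double[OF assms(1)] unfolding a2 a3 x1_def by algebra
  then show "x1 ^ 2 + x2 ^ 2 + x3 ^ 2 = - 2 * mf_a \<tau>"
    by (rule mult_left_cancel[THEN iffD1, rotated]) simp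
qed

section \<open>The Weierstrass function at the half period\<close>

text \<open>
  Differentiate the reflection formula \<open>\<Gamma>(z) \<Gamma>(1 - z) = \<pi> / sin (\<pi> z)\<close> logarithmically, and then once more.
\<close>

lemma trigamma_reflection:
  fixes z :: complex
  assumes z: "z \<notin> \<int>"
  shows "Polygamma 1 z + Polygamma 1 (1 - z) = of_real pi ^ 2 / sin (of_real pi * z) ^ 2"
proof -
  have op: "open (- \<int> :: complex set)" using closed_Ints by auto
  have nz: "sin (of_real pi * w) \<noteq> 0" if "w \<notin> \<int>" for w :: complex
  proof
    assume "sin (of_real pi * w) = 0"
    then obtain k :: int where "of_real pi * w = of_real (of_int k * pi)" unfolding sin_eq_0 by blast
    then have "w = of_int k" by simp
    with that show False by auto
  qed
  have ni: "w \<notin> \<int>\<^sub>\<le>\<^sub>0" "1 - w \<notin> \<int>\<^sub>\<le>\<^sub>0" if "w \<notin> \<int>" for w :: complex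
    using that nonpos_Ints_Int Ints_diff[of 1 "1 - w"] by auto
  have digamma: "Digamma w - Digamma (1 - w) = - of_real pi * (cos (of_real pi * w) / sin (of_real pi * w))"
    if w: "w \<notin> \<int>" for w :: complex
  proof -
    have "((\<lambda>w. Gamma w * Gamma (1 - w)) has_field_derivative
        Gamma w * Gamma (1 - w) * (Digamma w - Digamma (1 - w))) (at w)"
      by (rule derivative_eq_intros refl ni w)+ (simp add: algebra_simps)
    moreover have "((\<lambda>w. Gamma w * Gamma (1 - w)) has_field_derivative
        - (of_real pi ^ 2 * cos (of_real pi * w)) / sin (of_real pi * w) ^ 2) (at w)"
    proof -
      have "((\<lambda>w. of_real pi / sin (of_real pi * w)) has_field_derivative
        - (of_real pi ^ 2 * cos (of_real pi * w)) / sin (of_real pi * w) ^ 2) (at w)"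
        by (rule derivative_eq_intros refl nz w)+ (simp add: power2_eq_square)
      then show ?thesis by (simp add: Gamma_reflection_complex)
    qed
    ultimately have "Gamma w * Gamma (1 - w) * (Digamma w - Digamma (1 - w))
        = - (of_real pi ^ 2 * cos (of_real pi * w)) / sin (of_real pi * w) ^ 2"
      by (rule DERIV_unique)
    also have "\<dots> = Gamma w * Gamma (1 - w) * (- of_real pi * (cos (of_real pi * w) / sin (of_real pi * w)))"
      unfolding Gamma_reflection_complex by (simp add: power2_eq_square)
    finally show ?thesis
      by (rule mult_left_cancel[THEN iffD1, rotated])
         (use nz[OF w] in \<open>simp add: Gamma_reflection_complex\<close>)
  qed
  have "((\<lambda>w. Digamma w - Digamma (1 - w)) has_field_derivative Polygamma 1 z + Polygamma 1 (1 - z)) (at z)"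
    by (rule derivative_eq_intros refl ni z)+ simp
  moreover have "((\<lambda>w. Digamma w - Digamma (1 - w)) has_field_derivative of_real pi ^ 2 / sin (of_real pi * z) ^ 2) (at z)"
  proof (rule has_field_derivative_transform_within_open[OF _ op])
    let ?s = "sin (of_real pi * z)" and ?c = "cos (of_real pi * z)"
    have "((\<lambda>w. - of_real pi * (cos (of_real pi * w) / sin (of_real pi * w))) has_field_derivative
       of_real pi ^ 2 * (?s ^ 2 + ?c ^ 2) / ?s ^ 2) (at z)"
      by (rule derivative_eq_intros refl nz z)+ (use nz[OF z] in \<open>simp add: field_simps power2_eq_square
            del: sin_cos_squared_add sin_cos_squared_add2 sin_cos_squared_add3\<close>)
    then show "((\<lambda>w. - of_real pi * (cos (of_real pi * w) / sin (of_real pi * w))) has_field_derivative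
       of_real pi ^ 2 / ?s ^ 2) (at z)" by simp
  qed (use z digamma in auto)
  ultimately show ?thesis by (rule DERIV_unique)
qed

lemma trigamma_has_sum:
  fixes z :: complex
  assumes "z \<notin> \<int>"
  shows "((\<lambda>k. 1 / (z + of_nat k) ^ 2) has_sum Polygamma 1 z) UNIV"
proof (rule norm_summable_imp_has_sum)
  have z0: "z \<noteq> 0" using assms by auto
  have "summable (\<lambda>k. inverse ((z + of_nat k) ^ 2))"
    by (rule Polygamma_converges'[OF z0]) simp
  then show "(\<lambda>k. 1 / (z + of_nat k) ^ 2) sums Polygamma 1 z"
    by (simp add: sums_iff Polygamma_def inverse_eq_divide power2_eq_square)
  show "summable (\<lambda>k. norm (1 / (z + of_nat k) ^ 2))"
  proof (rule summable_comparison_test_ev)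
    show "summable (\<lambda>k. 4 * inverse (real k ^ 2))"
      by (intro summable_mult inverse_power_summable) simp
    show "\<forall>\<^sub>F k in sequentially. norm (norm (1 / (z + of_nat k) ^ 2)) \<le> 4 * inverse (real k ^ 2)"
    proof (rule eventually_mono[OF eventually_gt_at_top[of "nat \<lceil>2 * norm z\<rceil>"]])
      fix k assume "k > nat \<lceil>2 * norm z\<rceil>"
      then have k: "2 * norm z < real k" by linarith
      have "real k \<le> norm (z + of_nat k) + norm z"
        using norm_triangle_ineq4[of "z + of_nat k" z] by simp
      then have "real k / 2 \<le> norm (z + of_nat k)" using k by linarith
      then have "(real k / 2) ^ 2 \<le> norm (z + of_nat k) ^ 2" by (intro power_mono) auto
      moreover have "0 < real k" using k norm_ge_zero[of z] by linarith
      ultimately have "inverse (norm (z + of_nat k) ^ 2) \<le> inverse ((real k / 2) ^ 2)"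
        by (intro le_imp_inverse_le) auto
      then show "norm (norm (1 / (z + of_nat k) ^ 2)) \<le> 4 * inverse (real k ^ 2)"
        by (simp add: norm_divide norm_power inverse_eq_divide power_divide)
    qed
  qed
qed

lemma int_has_sum:
  fixes f :: "int \<Rightarrow> 'a :: {topological_ab_group_add, t2_space, comm_monoid_add}"
  assumes "((\<lambda>k. f (- int k)) has_sum a) UNIV" "((\<lambda>k. f (int k + 1)) has_sum b) UNIV"
  shows "(f has_sum (a + b)) UNIV"
proof -
  have "(f has_sum a) (range (\<lambda>k. - int k))"
    by (subst has_sum_reindex) (use assms(1) in \<open>auto simp: inj_on_def o_def\<close>)
  moreover have "(f has_sum b) (range (\<lambda>k. int k + 1))"
    by (subst has_sum_reindex) (use assms(2) in \<open>auto simp: inj_on_def o_def\<close>)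
  moreover have "range (\<lambda>k. - int k) \<inter> range (\<lambda>k. int k + 1) = {}" by auto
  ultimately have "(f has_sum (a + b)) (range (\<lambda>k. - int k) \<union> range (\<lambda>k. int k + 1))"
    by (rule has_sum_Un_disjoint)
  moreover have "range (\<lambda>k. - int k) \<union> range (\<lambda>k. int k + 1) = UNIV"
  proof -
    have "m \<in> range (\<lambda>k. - int k) \<union> range (\<lambda>k. int k + 1)" for m
    proof (cases "m \<le> 0")
      case True then show ?thesis by (auto intro!: image_eqI[of _ _ "nat (- m)"])
    next
      case False then show ?thesis by (auto intro!: image_eqI[of _ _ "nat (m - 1)"])
    qed
    then show ?thesis by blast
  qed
  ultimately show ?thesis by simp
qed

text \<open>
  The terms with \<open>m \<le> 0\<close> form the trigamma series at \<open>z\<close>, those with \<open>m > 0\<close> the series at \<open>1 - z\<close>.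
\<close>

lemma inverse_square_has_sum:
  fixes z :: complex
  assumes "z \<notin> \<int>"
  shows "((\<lambda>m. 1 / (z - of_int m) ^ 2) has_sum of_real pi ^ 2 / sin (of_real pi * z) ^ 2) UNIV"
  unfolding trigamma_reflection[OF assms, symmetric]
proof (rule int_has_sum)
  show "((\<lambda>k. 1 / (z - of_int (- int k)) ^ 2) has_sum Polygamma 1 z) UNIV"
    using trigamma_has_sum[OF assms] by simp
  have "1 - z \<notin> \<int>" using assms Ints_diff[of 1 "1 - z"] by auto
  from trigamma_has_sum[OF this]
  show "((\<lambda>k. 1 / (z - of_int (int k + 1)) ^ 2) has_sum Polygamma 1 (1 - z)) UNIV"
    by (rule has_sum_cong[THEN iffD1, rotated]) (simp add: power2_eq_square algebra_simps)
qed

lemma inverse_square_int_has_sum: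
  "((\<lambda>m. 1 / (of_int m :: complex) ^ 2) has_sum of_real pi ^ 2 / 3) UNIV"
proof -
  have "((\<lambda>n. 1 / real (Suc n) ^ 2) has_sum pi ^ 2 / 6) UNIV"
    by (rule sums_nonneg_imp_has_sum) (use inverse_squares_sums in \<open>simp_all add: add.commute\<close>)
  then have "((\<lambda>n. of_real (1 / real (Suc n) ^ 2) :: complex) has_sum of_real (pi ^ 2 / 6)) UNIV"
    by (simp only: has_sum_of_real_iff)
  then have *: "((\<lambda>n. 1 / (1 + of_nat n) ^ 2 :: complex) has_sum of_real pi ^ 2 / 6) UNIV"
    by simp
  have pos: "((\<lambda>k. 1 / (of_int (int k + 1) :: complex) ^ 2) has_sum of_real pi ^ 2 / 6) UNIV"
    using * by (simp add: add.commute)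
  have "((\<lambda>k. 1 / (of_int (- int k) :: complex) ^ 2) has_sum of_real pi ^ 2 / 6) (range Suc)"
    by (subst has_sum_reindex) (use * in \<open>auto simp: o_def\<close>)
  then have neg: "((\<lambda>k. 1 / (of_int (- int k) :: complex) ^ 2) has_sum of_real pi ^ 2 / 6) UNIV"
    by (rule has_sum_cong_neutral[THEN iffD1, rotated -1]) (auto simp: image_iff, metis not0_implies_Suc)
  from int_has_sum[OF neg pos] show ?thesis by simp
qed


text \<open>
  Lambert's rearrangement: the double series in \<open>(n, d)\<close> is grouped by the value of \<open>n d\<close>.
\<close>

lemma lambert_has_sum:
  fixes g :: "nat \<Rightarrow> complex"
  assumes g: "\<And>d. norm (g d) \<le> of_nat d ^ k" and q: "norm q < 1"
    and H: "\<And>n. n \<ge> 1 \<Longrightarrow> ((\<lambda>d. g d * q ^ (n * d)) has_sum H n) {1..}"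
  shows "(H has_sum eval_fps (lambert g) q) {1..}"
proof -
  let ?D = "\<lambda>N. {d. d dvd N \<and> 0 < (N :: nat)}"
  let ?f = "\<lambda>(N, d). g d * q ^ N"
  have "(\<lambda>p. norm (?f p)) summable_on (SIGMA N:UNIV. ?D N)"
  proof (rule summable_on_SigmaI)
    show "((\<lambda>d. norm (?f (N, d))) has_sum (\<Sum>d\<in>?D N. norm (g d) * norm q ^ N)) (?D N)" for N
      by (rule has_sum_finiteI) (auto simp: norm_mult norm_power)
    have r: "fps_conv_radius (lambert (\<lambda>d. of_real (norm (g d)))) \<ge> 1"
      by (rule conv_radius_lambert[of _ k]) (use g in simp)
    have "ereal (norm q) < fps_conv_radius (lambert (\<lambda>d. of_real (norm (g d))))"
      by (rule less_le_trans[OF _ r]) (use q in simp)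
    then have "summable (\<lambda>N. norm (fps_nth (lambert (\<lambda>d. of_real (norm (g d)))) N * q ^ N))"
      unfolding fps_conv_radius_def by (rule abs_summable_in_conv_radius)
    moreover have "norm (fps_nth (lambert (\<lambda>d. of_real (norm (g d)))) N * q ^ N)
        = (\<Sum>d\<in>?D N. norm (g d) * norm q ^ N)" for N
    proof -
      have "norm (\<Sum>d\<in>?D N. of_real (norm (g d)) :: complex) = (\<Sum>d\<in>?D N. norm (g d))"
        unfolding of_real_sum[symmetric] norm_of_real by (simp add: sum_nonneg)
      then show ?thesis by (simp add: lambert_def norm_mult norm_power flip: sum_distrib_right)
    qed
    ultimately show "(\<lambda>N. \<Sum>d\<in>?D N. norm (g d) * norm q ^ N) summable_on UNIV"
      by (intro summable_nonneg_imp_summable_on) (simp_all add: sum_nonneg)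
  qed simp
  then have summ: "?f summable_on (SIGMA N:UNIV. ?D N)"
    by (rule abs_summable_summable)
  define S where "S = infsum ?f (SIGMA N:UNIV. ?D N)"
  have S: "(?f has_sum S) (SIGMA N:UNIV. ?D N)"
    unfolding S_def using summ by (rule has_sum_infsum)
  have "((\<lambda>N. fps_nth (lambert g) N * q ^ N) has_sum S) UNIV"
  proof (rule has_sum_SigmaD[OF S])
    show "((\<lambda>d. ?f (N, d)) has_sum (fps_nth (lambert g) N * q ^ N)) (?D N)" for N
      by (rule has_sum_finiteI) (auto simp: lambert_def sum_distrib_right)
  qed
  then have "(\<lambda>N. fps_nth (lambert g) N * q ^ N) sums S" by (rule has_sum_imp_sums)
  with eval_fps_sums[OF conv_radius_lambert[OF g] q] have eq: "S = eval_fps (lambert g) q"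
    by (rule sums_unique2[rotated])
  have bij: "bij_betw (\<lambda>(n, d). (n * d, d)) ({1..} \<times> {1..}) (SIGMA N:UNIV. ?D N)"
    by (rule bij_betw_byWitness[of _ "\<lambda>(N, d). (N div d, d)"])
       (auto elim!: dvdE simp: Suc_le_eq)
  have "((\<lambda>p. ?f ((\<lambda>(n, d). (n * d, d)) p)) has_sum S) ({1..} \<times> {1..})"
    using S by (simp only: has_sum_reindex_bij_betw[OF bij])
  then have "((\<lambda>(n, d). g d * q ^ (n * d)) has_sum S) ({1..} \<times> {1..})"
    by (simp add: case_prod_unfold)
  then show ?thesis unfolding eq[symmetric]
    by (rule has_sum_SigmaD) (use H in auto)
qed

lemma has_sum_minus:
  fixes f g :: "'a \<Rightarrow> complex"
  assumes "(f has_sum a) A" "(g has_sum b) A"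
  shows "((\<lambda>x. f x - g x) has_sum (a - b)) A"
  using has_sum_add[OF assms(1), of "\<lambda>x. - g x" "- b"] assms(2) by (simp add: has_sum_uminus)

lemma bij_add_1: "bij_betw (\<lambda>n. n + 1) UNIV {1::nat..}"
  by (rule bij_betw_byWitness[of _ "\<lambda>n. n - 1"]) auto

lemma int_even_has_sum:
  fixes h :: "int \<Rightarrow> complex"
  assumes h: "(h has_sum T) UNIV" and even: "\<And>n. h (- n) = h n"
    and pos: "((\<lambda>n. h (int n)) has_sum S) {1..}"
  shows "T = h 0 + 2 * S"
proof -
  have 1: "((\<lambda>n. h (int (n + 1))) has_sum S) UNIV"
    using pos has_sum_reindex_bij_betw[of "\<lambda>n. n + 1" UNIV "{1..}" "\<lambda>n. h (int n)" S]
    using bij_add_1 by simp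
  have "((\<lambda>n. h (- int n)) has_sum (h 0 + S)) ({0} \<union> {1..})"
    by (rule has_sum_Un_disjoint) (use pos even in \<open>auto intro: has_sum_finiteI\<close>)
  moreover have "{0} \<union> {1..} = (UNIV :: nat set)" by auto
  ultimately have 2: "((\<lambda>n. h (- int n)) has_sum (h 0 + S)) UNIV" by simp
  have "(h has_sum ((h 0 + S) + S)) UNIV"
    by (rule int_has_sum[OF 2]) (use 1 in \<open>simp add: add.commute\<close>)
  with h have "T = (h 0 + S) + S" by (rule has_sum_unique)
  then show ?thesis by simp
qed

text \<open>
  The series \<open>\<Sum> d y\<^sup>d = y / (1 - y)\<^sup>2\<close> minus the same series at \<open>- y\<close> keeps the odd terms, doubled.
\<close>

lemma odd_geometric_has_sum:
  assumes "norm (y :: complex) < 1"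
  shows "((\<lambda>d. (1 - ev d) * of_nat d * y ^ d) has_sum ((y / (1 + y) ^ 2 + y / (1 - y) ^ 2) / 2)) {1..}"
proof -
  have geom: "((\<lambda>d. of_nat d * x ^ d) has_sum (x / (1 - x) ^ 2)) {1..}" if x: "norm x < 1" for x :: complex
  proof -
    have "(\<lambda>n. of_nat (Suc n) * x ^ n) sums (1 / (1 - x) ^ 2)" by (rule geometric_deriv_sums[OF x])
    moreover have "summable (\<lambda>n. norm (of_nat (Suc n) * x ^ n))"
      using sums_summable[OF geometric_deriv_sums[of "norm x"]] x by (simp add: norm_mult norm_power del: of_nat_Suc)
    ultimately have "((\<lambda>n. of_nat (Suc n) * x ^ n) has_sum (1 / (1 - x) ^ 2)) UNIV"
      by (intro norm_summable_imp_has_sum)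
    then have "((\<lambda>n. of_nat (Suc n) * x ^ n * x) has_sum (1 / (1 - x) ^ 2 * x)) UNIV"
      by (rule has_sum_cmult_left)
    then have "((\<lambda>n. (of_nat (n + 1)) * x ^ (n + 1)) has_sum (x / (1 - x) ^ 2)) UNIV"
      by (simp add: mult_ac)
    moreover note bij_add_1
    ultimately show ?thesis
      using has_sum_reindex_bij_betw[of "\<lambda>n. n + 1" UNIV "{1..}" "\<lambda>d. of_nat d * x ^ d" "x / (1 - x) ^ 2"] by blast
  qed
  have "((\<lambda>d. of_nat d * y ^ d + - (of_nat d * (- y) ^ d)) has_sum (y / (1 - y) ^ 2 + - (- y / (1 - - y) ^ 2))) {1..}"
    by (intro has_sum_add has_sum_uminus[THEN iffD2]) (use geom[of y] geom[of "- y"] assms in simp_all)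
  then have "((\<lambda>d. (of_nat d * y ^ d + - (of_nat d * (- y) ^ d)) * (1/2)) has_sum
      ((y / (1 - y) ^ 2 + - (- y / (1 - - y) ^ 2)) * (1/2))) {1..}"
    by (rule has_sum_cmult_left)
  moreover have "(of_nat d * y ^ d + - (of_nat d * (- y) ^ d)) * (1/2) = (1 - ev d) * of_nat d * y ^ d" for d
    by (auto simp: power_minus_odd power_minus_even)
  ultimately show ?thesis by (simp add: add_ac)
qed


text \<open>
  The imaginary part of \<open>x + y \<tau>\<close> controls \<open>y\<close>, and then \<open>x\<close> is controlled by the triangle inequality.
\<close>

lemma lattice_norm_lower_bound:
  assumes "Im \<tau> > 0"
  obtains K where "K > 0" "\<And>x y. \<bar>x\<bar> + \<bar>y\<bar> \<le> K * norm (of_real x + of_real y * \<tau>)"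
proof
  let ?K = "1 + (1 + norm \<tau>) / Im \<tau>"
  show "?K > 0" using assms norm_ge_zero[of \<tau>] by (intro add_pos_nonneg) auto
  fix x y :: real
  let ?w = "of_real x + of_real y * \<tau>"
  have "\<bar>y\<bar> * Im \<tau> = \<bar>Im ?w\<bar>" using assms by (simp add: abs_mult)
  also have "\<dots> \<le> norm ?w" by (rule abs_Im_le_cmod)
  finally have y: "\<bar>y\<bar> \<le> norm ?w / Im \<tau>" using assms by (simp add: field_simps)
  have "\<bar>x\<bar> = norm (?w - of_real y * \<tau>)" by simp
  also have "\<dots> \<le> norm ?w + norm (of_real y * \<tau>)" by (rule norm_triangle_ineq4)
  finally have x: "\<bar>x\<bar> \<le> norm ?w + \<bar>y\<bar> * norm \<tau>" by (simp add: norm_mult)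
  have "\<bar>x\<bar> + \<bar>y\<bar> \<le> norm ?w + \<bar>y\<bar> * (1 + norm \<tau>)" using x by (simp add: algebra_simps)
  also have "\<dots> \<le> norm ?w + norm ?w / Im \<tau> * (1 + norm \<tau>)"
    by (intro add_left_mono mult_right_mono y) simp
  finally show "\<bar>x\<bar> + \<bar>y\<bar> \<le> ?K * norm ?w" by (simp add: algebra_simps)
qed

lemma summable_int_powr: "(\<lambda>n::int. (1 + \<bar>of_int n\<bar>) powr (- 3/2) :: real) summable_on UNIV"
proof -
  have s: "summable (\<lambda>n. (1 + real n) powr (- 3/2))"
  proof -
    have "summable (\<lambda>n. real (n + 1) powr (- 3/2))"
      by (rule summable_ignore_initial_segment) (simp add: summable_real_powr_iff)
    then show ?thesis by (simp add: add.commute)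
  qed
  then obtain a where a: "((\<lambda>n. (1 + real n) powr (- 3/2)) has_sum a) UNIV"
    using summable_nonneg_imp_summable_on[OF s] by (auto simp: summable_on_def)
  have "summable (\<lambda>n. (1 + real (n + 1)) powr (- 3/2))"
    using s by (rule summable_ignore_initial_segment)
  then obtain b where "((\<lambda>n. (1 + real (n + 1)) powr (- 3/2)) has_sum b) UNIV"
    using summable_nonneg_imp_summable_on by (fastforce simp: summable_on_def)
  then have "((\<lambda>n::int. (1 + \<bar>of_int n\<bar>) powr (- 3/2) :: real) has_sum (a + b)) UNIV"
    using a by (intro int_has_sum) (simp_all add: add_ac)
  then show ?thesis by (auto simp: summable_on_def)
qed

text \<open>
  With \<open>u = \<omega>\<close> and \<open>v = 1/2 - \<omega>\<close> the difference \<open>1 / v\<^sup>2 - 1 / u\<^sup>2\<close> has the factor \<open>u + v = 1/2\<close>, so it is of third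
  order in the size \<open>N\<close> of the lattice point.
\<close>

lemma wp_term_bound:
  fixes u v :: complex
  assumes "u + v = 1/2" "K > 0" "N > 0" "N \<le> K * norm u" "N \<le> K * (2 * norm v)"
  shows "norm (1 / v ^ 2 - 1 / u ^ 2) \<le> 3 * K ^ 3 / N ^ 3"
proof -
  have u: "norm u \<ge> N / K" and v: "norm v \<ge> N / (2 * K)" and NK: "N / K > 0" "N / (2 * K) > 0"
    using assms by (auto simp: field_simps)
  then have nz: "u \<noteq> 0" "v \<noteq> 0" by auto
  have "1 / v ^ 2 - 1 / u ^ 2 = (u + v) * (u - v) / (u ^ 2 * v ^ 2)"
    using nz by (simp add: field_simps power2_eq_square)
  also have "\<dots> = 1/2 * (1 / (u * v ^ 2) - 1 / (u ^ 2 * v))"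
    unfolding assms(1) using nz by (simp add: field_simps power2_eq_square)
  finally have split: "1 / v ^ 2 - 1 / u ^ 2 = 1/2 * (1 / (u * v ^ 2) - 1 / (u ^ 2 * v))" .
  have "norm (1 / v ^ 2 - 1 / u ^ 2) = 1/2 * norm (1 / (u * v ^ 2) - 1 / (u ^ 2 * v))"
    unfolding split norm_mult by simp
  also have "\<dots> \<le> 1/2 * (norm (1 / (u * v ^ 2)) + norm (1 / (u ^ 2 * v)))"
    by (intro mult_left_mono norm_triangle_ineq4) simp
  also have "norm (1 / (u * v ^ 2)) \<le> 1 / (N / K * (N / (2 * K)) ^ 2)"
    unfolding norm_divide norm_mult norm_power norm_one
    using NK u v by (intro divide_left_mono mult_mono power_mono mult_pos_pos zero_less_power) auto
  also have "norm (1 / (u ^ 2 * v)) \<le> 1 / ((N / K) ^ 2 * (N / (2 * K)))"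
    unfolding norm_divide norm_mult norm_power norm_one
    using NK u v by (intro divide_left_mono mult_mono power_mono mult_pos_pos zero_less_power) auto
  also have "1/2 * (1 / (N / K * (N / (2 * K)) ^ 2) + 1 / ((N / K) ^ 2 * (N / (2 * K)))) = 3 * K ^ 3 / N ^ 3"
    using assms by (simp add: field_simps power2_eq_square power3_eq_cube)
  finally show ?thesis by simp
qed

lemma lattice_bij:
  assumes "Im \<tau> > 0"
  shows "bij_betw (\<lambda>(n, m). of_int m + of_int n * \<tau>) UNIV (lattice \<tau>)"
proof -
  have "inj (\<lambda>(n, m). of_int m + of_int n * \<tau> :: complex)"
    by (rule injI) (use assms in \<open>auto simp: complex_eq_iff\<close>)
  moreover have "range (\<lambda>(n, m). of_int m + of_int n * \<tau>) = lattice \<tau>"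
    by (auto simp: lattice_def image_iff)
  ultimately show ?thesis by (simp add: bij_betw_def)
qed

text \<open>
  As \<open>1 / 0 = 0\<close>, the term at \<open>\<omega> = 0\<close> equals \<open>1 / (1/2)\<^sup>2\<close>, the separate first term of \<open>\<wp>(1/2)\<close>. So \<open>\<wp>(1/2)\<close> is one
  sum over the whole lattice. The terms are of order \<open>N\<^sup>-\<^sup>3\<close> with \<open>N = |m| + |n|\<close>, and \<open>N\<^sup>2\<close> is at least a quarter of
  \<open>(1 + |m|) (1 + |n|)\<close>. This bounds them by a product of two summable functions of one integer each.
\<close>

lemma wp_half_summable:
  assumes "Im \<tau> > 0"
  shows "(\<lambda>\<omega>. 1 / (1/2 - \<omega>) ^ 2 - 1 / \<omega> ^ 2) summable_on lattice \<tau>"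
proof -
  obtain K where K: "K > 0" "\<And>x y. \<bar>x\<bar> + \<bar>y\<bar> \<le> K * norm (of_real x + of_real y * \<tau>)"
    using lattice_norm_lower_bound[OF assms] by blast
  let ?w = "\<lambda>(n, m). of_int m + of_int n * \<tau>"
  let ?t = "\<lambda>\<omega>::complex. 1 / (1/2 - \<omega>) ^ 2 - 1 / \<omega> ^ 2"
  let ?p = "\<lambda>n::int. (1 + \<bar>of_int n\<bar>) powr (- 3/2) :: real"
  have "norm (?t (?w (n, m))) \<le> (4 + 24 * K ^ 3) * (?p n * ?p m)" for n m
  proof (cases "n = 0 \<and> m = 0")
    case True
    then show ?thesis using K by (simp add: power2_eq_square)
  next
    case False
    define N where "N = \<bar>real_of_int m\<bar> + \<bar>real_of_int n\<bar>"
    have N1: "N \<ge> 1" using False by (auto simp: N_def)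
    have N2: "1 + \<bar>real_of_int n\<bar> \<le> 2 * N" "1 + \<bar>real_of_int m\<bar> \<le> 2 * N"
      using N1 by (auto simp: N_def)
    have "norm (?t (?w (n, m))) \<le> 3 * K ^ 3 / N ^ 3"
    proof (rule wp_term_bound)
      show "N \<le> K * norm (?w (n, m))"
        using K(2)[of "of_int m" "of_int n"] by (simp add: N_def)
      \<comment> \<open>The point \<open>1 - 2 \<omega>\<close> has the odd real coordinate \<open>1 - 2 m\<close>, which is at least \<open>|m|\<close> in size.\<close>
      have "1 - 2 * m \<noteq> 0" by presburger
      then have "\<bar>m\<bar> \<le> \<bar>1 - 2 * m\<bar>" by linarith
      then have "\<bar>real_of_int m\<bar> \<le> \<bar>1 - 2 * real_of_int m\<bar>"
        by (metis (mono_tags) of_int_1 of_int_abs of_int_diff of_int_le_iff of_int_mult of_int_numeral)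
      then have "N \<le> \<bar>1 - 2 * real_of_int m\<bar> + \<bar>- 2 * real_of_int n\<bar>" by (simp add: N_def)
      also have "\<dots> \<le> K * norm (of_real (1 - 2 * real_of_int m) + of_real (- 2 * real_of_int n) * \<tau>)"
        by (rule K(2))
      also have "of_real (1 - 2 * real_of_int m) + of_real (- 2 * real_of_int n) * \<tau> = 2 * (1/2 - ?w (n, m))"
        by (simp add: algebra_simps)
      finally show "N \<le> K * (2 * norm (1/2 - ?w (n, m)))" by (simp only: norm_mult norm_numeral)
    qed (use K N1 in auto)
    also have "3 * K ^ 3 / N ^ 3 = 24 * K ^ 3 * ((2 * N) powr (- 3/2) * (2 * N) powr (- 3/2))"
    proof -
      have "(2 * N) powr (- 3/2) * (2 * N) powr (- 3/2) = (2 * N) powr (- 3)"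
        by (simp add: powr_add[symmetric])
      also have "\<dots> = 1 / (2 * N) ^ 3" using N1 by (simp add: powr_minus_divide powr_numeral)
      finally have p: "(2 * N) powr (- 3/2) * (2 * N) powr (- 3/2) = 1 / (2 * N) ^ 3" .
      show ?thesis unfolding p by (simp add: power_mult_distrib)
    qed
    also have "\<dots> \<le> 24 * K ^ 3 * (?p n * ?p m)"
      using N1 N2 K by (intro mult_left_mono mult_mono powr_mono2') auto
    also have "\<dots> \<le> (4 + 24 * K ^ 3) * (?p n * ?p m)"
      by (intro mult_right_mono) auto
    finally show ?thesis .
  qed
  then have bound: "norm ((\<lambda>p. ?t (?w p)) p) \<le> (\<lambda>(n, m). (4 + 24 * K ^ 3) * (?p n * ?p m)) p" for p
    by (cases p) auto
  have "(\<lambda>(n, m). (4 + 24 * K ^ 3) * (?p n * ?p m)) summable_on (UNIV \<times> UNIV)"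
  proof (rule summable_on_SigmaI)
    show "((\<lambda>m. (\<lambda>(n, m). (4 + 24 * K ^ 3) * (?p n * ?p m)) (n, m)) has_sum
        ((4 + 24 * K ^ 3) * ?p n * infsum ?p UNIV)) UNIV" for n
      using has_sum_cmult_right[OF has_sum_infsum[OF summable_int_powr], of "(4 + 24 * K ^ 3) * ?p n"]
      by (simp add: mult_ac)
    show "(\<lambda>n. (4 + 24 * K ^ 3) * ?p n * infsum ?p UNIV) summable_on UNIV"
      by (intro summable_on_cmult_left summable_on_cmult_right summable_int_powr)
  qed (use K in auto)
  then have "(\<lambda>p. norm (?t (?w p))) summable_on UNIV"
    unfolding UNIV_Times_UNIV by (rule Infinite_Sum.abs_summable_on_comparison_test') (rule bound)
  then have "(\<lambda>p. ?t (?w p)) summable_on UNIV" by (rule abs_summable_summable)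
  then show ?thesis using summable_on_reindex_bij_betw[OF lattice_bij[OF assms], of ?t] by simp
qed

lemma wp_half_infsum:
  assumes "Im \<tau> > 0"
  shows "wp \<tau> (1/2) = (\<Sum>\<^sub>\<infinity>\<omega>\<in>lattice \<tau>. 1 / (1/2 - \<omega>) ^ 2 - 1 / \<omega> ^ 2)"
proof -
  let ?t = "\<lambda>\<omega>::complex. 1 / (1/2 - \<omega>) ^ 2 - 1 / \<omega> ^ 2"
  have "0 \<in> lattice \<tau>" by (auto simp: lattice_def intro!: exI[of _ "0::int"])
  then have "infsum ?t (lattice \<tau>) = infsum ?t ({0} \<union> (lattice \<tau> - {0}))"
    by (intro arg_cong[of _ _ "infsum ?t"]) auto
  also have "\<dots> = infsum ?t {0} + infsum ?t (lattice \<tau> - {0})"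
    by (rule infsum_Un_disjoint) (auto intro: summable_on_subset_banach[OF wp_half_summable[OF assms]])
  finally show ?thesis by (simp add: wp_def)
qed

lemma pi_sin_square:
  fixes z :: complex
  defines "w \<equiv> exp (2 * of_real pi * \<i> * z)"
  shows "of_real pi ^ 2 / sin (of_real pi * z) ^ 2 = - 4 * of_real pi ^ 2 * (w / (1 - w) ^ 2)"
proof -
  define x where "x = exp (\<i> * (of_real pi * z))"
  have x0: "x \<noteq> 0" by (simp add: x_def)
  have w: "w = x ^ 2" unfolding w_def x_def exp_of_nat_mult[symmetric] by (simp add: algebra_simps)
  have s: "sin (of_real pi * z) = (x - inverse x) / (2 * \<i>)"
    unfolding sin_exp_eq x_def by (simp add: exp_minus)
  have "sin (of_real pi * z) ^ 2 = - ((1 - w) ^ 2) / (4 * w)"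
    unfolding s w using x0 by (simp add: field_simps power2_eq_square)
  then show ?thesis by simp
qed

text \<open>
  Summing over \<open>m\<close> first, the row \<open>n \<noteq> 0\<close> gives a difference of two values of \<open>\<pi>\<^sup>2 / sin\<^sup>2\<close>, that is
  \<open>4 \<pi>\<^sup>2 (y / (1 + y)\<^sup>2 + y / (1 - y)\<^sup>2)\<close> with \<open>y = q\<^sup>|\<^sup>n\<^sup>|\<close>. This is \<open>8 \<pi>\<^sup>2 \<Sum> d y\<^sup>d\<close> over odd \<open>d\<close>, and the sum over
  \<open>n\<close> is a Lambert series. The row \<open>n = 0\<close> gives \<open>\<pi>\<^sup>2 - \<pi>\<^sup>2 / 3\<close>.
\<close>

lemma mf_e_eval:
  assumes "Im \<tau> > 0"
  shows "mf_e \<tau> = - (2/3) * (1 + 24 * eval_fps (lambert (\<lambda>d. (1 - ev d) * of_nat d)) (nome \<tau>))"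
proof -
  let ?t = "\<lambda>\<omega>::complex. 1 / (1/2 - \<omega>) ^ 2 - 1 / \<omega> ^ 2"
  let ?w = "\<lambda>(n, m). of_int m + of_int n * \<tau>"
  let ?g = "\<lambda>w::complex. w / (1 - w) ^ 2"
  define q where "q = nome \<tau>"
  have q: "norm q < 1" "q \<noteq> 0" using norm_nome_less_1[OF assms] by (auto simp: q_def nome_def)
  define h where "h = (\<lambda>n::int. if n = 0 then of_real pi ^ 2 - of_real pi ^ 2 / 3
      else 4 * of_real pi ^ 2 * (?g (q powi (- n)) - ?g (- (q powi (- n)))))"
  have nz: "z \<notin> \<int>" if "Im z \<noteq> 0" for z using that by (auto simp: complex_is_Int_iff)
  have inner: "((\<lambda>m. ?t (?w (n, m))) has_sum h n) UNIV" for n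
  proof (cases "n = 0")
    case True
    have half: "(1/2 :: complex) \<notin> \<int>" using fraction_not_in_Ints[where 'a = complex, of 2 1] by simp
    have "((\<lambda>m. 1 / (1/2 - of_int m :: complex) ^ 2 - 1 / (of_int m) ^ 2) has_sum
        (of_real pi ^ 2 / sin (of_real pi * (1/2)) ^ 2 - of_real pi ^ 2 / 3)) (UNIV :: int set)"
      by (rule has_sum_minus[OF inverse_square_has_sum[OF half] inverse_square_int_has_sum])
    moreover have "sin (of_real pi * (1/2)) = (1 :: complex)"
      using sin_of_real[of "pi / 2", where 'a = complex] by simp
    ultimately show ?thesis using True by (simp add: h_def)
  next
    case False
    let ?z1 = "1/2 - of_int n * \<tau>" and ?z2 = "- of_int n * \<tau>"
    have ni: "?z1 \<notin> \<int>" "?z2 \<notin> \<int>" by (rule nz, use False assms in simp)+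
    have "((\<lambda>m. 1 / (?z1 - of_int m) ^ 2 - 1 / (?z2 - of_int m) ^ 2) has_sum
        (of_real pi ^ 2 / sin (of_real pi * ?z1) ^ 2 - of_real pi ^ 2 / sin (of_real pi * ?z2) ^ 2)) UNIV"
      by (rule has_sum_minus[OF inverse_square_has_sum[OF ni(1)] inverse_square_has_sum[OF ni(2)]])
    moreover have "1 / (?z1 - of_int m) ^ 2 - 1 / (?z2 - of_int m) ^ 2 = ?t (?w (n, m))" for m
    proof -
      have "(?z2 - of_int m) ^ 2 = (?w (n, m)) ^ 2" by (simp add: power2_eq_square algebra_simps)
      moreover have "?z1 - of_int m = 1/2 - ?w (n, m)" by simp
      ultimately show ?thesis by (simp only:)
    qed
    moreover have "of_real pi ^ 2 / sin (of_real pi * ?z1) ^ 2 - of_real pi ^ 2 / sin (of_real pi * ?z2) ^ 2 = h n"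
    proof -
      have e2: "exp (2 * of_real pi * \<i> * ?z2) = q powi (- n)"
        unfolding q_def nome_def exp_power_int by (simp add: algebra_simps)
      have "2 * of_real pi * \<i> * ?z1 = of_real pi * \<i> + 2 * of_real pi * \<i> * ?z2" by (simp add: algebra_simps)
      then have "exp (2 * of_real pi * \<i> * ?z1) = - exp (2 * of_real pi * \<i> * ?z2)"
        by (simp only: exp_add exp_pi_i) simp
      then show ?thesis unfolding pi_sin_square e2 using False by (simp add: h_def e2 algebra_simps)
    qed
    ultimately show ?thesis by simp
  qed
  have "(?t has_sum wp \<tau> (1/2)) (lattice \<tau>)"
    unfolding wp_half_infsum[OF assms] by (rule has_sum_infsum[OF wp_half_summable[OF assms]])
  then have "((\<lambda>p. ?t (?w p)) has_sum wp \<tau> (1/2)) (UNIV \<times> UNIV)"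
    using has_sum_reindex_bij_betw[OF lattice_bij[OF assms], of ?t] by simp
  then have H: "(h has_sum wp \<tau> (1/2)) UNIV"
    by (rule has_sum_SigmaD) (use inner in auto)
  \<comment> \<open>The sign of \<open>n\<close> is immaterial because \<open>w / (1 - w)\<^sup>2\<close> is invariant under inversion.\<close>
  have ginv: "?g (inverse w) = ?g w" if "w \<noteq> 0" "w \<noteq> 1" for w
    using that by (simp add: field_simps power2_eq_square)
  have hn: "h (int n) = 8 * of_real pi ^ 2 * ((q ^ n / (1 + q ^ n) ^ 2 + q ^ n / (1 - q ^ n) ^ 2) / 2)
      \<and> h (- int n) = h (int n)" if "n \<ge> 1" for n :: nat
  proof -
    have "norm (q ^ n) < 1" using q that by (simp add: norm_power power_less_one_iff)
    then have y: "q ^ n \<noteq> 1" "- (q ^ n) \<noteq> 1" "q ^ n \<noteq> 0"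
      using q norm_minus_cancel[of "q ^ n"] by (auto simp del: norm_minus_cancel)
    have g: "?g (inverse (q ^ n)) = ?g (q ^ n)" "?g (- inverse (q ^ n)) = ?g (- (q ^ n))"
      using ginv[of "q ^ n"] ginv[of "- (q ^ n)"] y by (simp_all only: inverse_minus_eq) auto
    have p: "q powi (- int n) = inverse (q ^ n)" "q powi (- (- int n)) = q ^ n"
      by (simp_all add: power_int_minus)
    have n0: "int n \<noteq> 0" "- int n \<noteq> 0" using that by auto
    have "?g (q ^ n) - ?g (- (q ^ n)) = q ^ n / (1 + q ^ n) ^ 2 + q ^ n / (1 - q ^ n) ^ 2" by simp
    then show ?thesis
      unfolding h_def if_not_P[OF n0(1)] if_not_P[OF n0(2)] p g by simp
  qed
  have "((\<lambda>n. (q ^ n / (1 + q ^ n) ^ 2 + q ^ n / (1 - q ^ n) ^ 2) / 2) has_sum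
      eval_fps (lambert (\<lambda>d. (1 - ev d) * of_nat d)) q) {1..}"
  proof (rule lambert_has_sum[of _ 1])
    fix n :: nat assume "n \<ge> 1"
    then have "norm (q ^ n) < 1" using q by (simp add: norm_power power_less_one_iff)
    from odd_geometric_has_sum[OF this]
    show "((\<lambda>d. (1 - ev d) * of_nat d * q ^ (n * d)) has_sum
        ((q ^ n / (1 + q ^ n) ^ 2 + q ^ n / (1 - q ^ n) ^ 2) / 2)) {1..}"
      by (simp add: power_mult)
  qed (use q in auto)
  then have "((\<lambda>n. 8 * of_real pi ^ 2 * ((q ^ n / (1 + q ^ n) ^ 2 + q ^ n / (1 - q ^ n) ^ 2) / 2)) has_sum
      8 * of_real pi ^ 2 * eval_fps (lambert (\<lambda>d. (1 - ev d) * of_nat d)) q) {1..}"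
    by (rule has_sum_cmult_right)
  then have pos: "((\<lambda>n. h (int n)) has_sum (8 * of_real pi ^ 2 * eval_fps (lambert (\<lambda>d. (1 - ev d) * of_nat d)) q)) {1..}"
    by (rule has_sum_cong[THEN iffD1, rotated]) (use hn in auto)
  have even: "h (- n) = h n" for n
  proof (cases "n = 0")
    case False
    then have "nat \<bar>n\<bar> \<ge> 1" by auto
    from hn[OF this] show ?thesis by (cases "n \<ge> 0") auto
  qed simp
  have "wp \<tau> (1/2) = h 0 + 2 * (8 * of_real pi ^ 2 * eval_fps (lambert (\<lambda>d. (1 - ev d) * of_nat d)) q)"
    by (rule int_even_has_sum[OF H even pos])
  then show ?thesis by (simp add: mf_e_def h_def q_def field_simps)
qed

lemma mf_e_eq_phi: "Im \<tau> > 0 \<Longrightarrow> mf_e \<tau> = phi \<tau>"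
  unfolding phi_def E2_level2_odd
  by (subst eval_combine)
     (simp_all add: mf_e_eval norm_nome_less_1 eval_combine conv_radius_combine conv_radius_lambert[of _ 1])

section \<open>Algebraic independence\<close>

text \<open>
  Division by \<open>c\<close> maps the lattice of \<open>\<tau>\<close> onto that of \<open>\<tau>/c\<close>, whence \<open>\<wp>(1/2)\<close> for the new lattice is \<open>c\<^sup>2 \<wp>(c/2)\<close>
  for the old one. As \<open>c/2 = 1/2 + k \<tau>\<close>, it remains to shift the argument of \<open>\<wp>\<close> by the lattice point \<open>k \<tau>\<close>.
\<close>

lemma mf_e_transform:
  fixes \<tau> :: complex and k :: nat
  assumes im: "Im \<tau> > 0"
  defines "c \<equiv> 2 * of_nat k * \<tau> + 1"
  shows "mf_e (\<tau> / c) = c ^ 2 * mf_e \<tau>" "c \<noteq> 0" "Im (\<tau> / c) > 0"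
proof -
  show c0: "c \<noteq> 0"
  proof
    assume "c = 0"
    then have "Im c = 0" by simp
    then have "k = 0" using im by (simp add: c_def)
    then show False using \<open>c = 0\<close> by (simp add: c_def)
  qed
  have "Im (\<tau> * cnj c) = Im \<tau>" by (simp add: c_def algebra_simps)
  then show im': "Im (\<tau> / c) > 0"
    using im c0 by (simp add: Im_complex_div_gt_0)
  define f where "f = (\<lambda>\<omega>. 1 / (c / 2 - \<omega>) ^ 2 - 1 / \<omega> ^ 2)"
  define g where "g = (\<lambda>\<omega>::complex. 1 / (1 / 2 - \<omega>) ^ 2 - 1 / \<omega> ^ 2)"
  let ?L = "lattice \<tau>"
  have L: "of_int m + of_int n * \<tau> \<in> ?L" for m n by (auto simp: lattice_def)
  have bij: "bij_betw (\<lambda>\<omega>. \<omega> / c) ?L (lattice (\<tau> / c))"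
  proof (rule bij_betw_byWitness[of _ "\<lambda>\<omega>. \<omega> * c"])
    show "(\<lambda>\<omega>. \<omega> / c) ` ?L \<subseteq> lattice (\<tau> / c)"
    proof (safe)
      fix \<omega> assume "\<omega> \<in> ?L"
      then obtain m n where \<omega>: "\<omega> = of_int m + of_int n * \<tau>" by (auto simp: lattice_def)
      have "\<omega> = of_int m * c + of_int (n - 2 * int k * m) * \<tau>"
        by (simp add: \<omega> c_def algebra_simps)
      then have "\<omega> / c = of_int m + of_int (n - 2 * int k * m) * (\<tau> / c)"
        using c0 by (simp add: field_simps)
      then show "\<omega> / c \<in> lattice (\<tau> / c)" unfolding lattice_def by blast
    qed
    show "(\<lambda>\<omega>. \<omega> * c) ` lattice (\<tau> / c) \<subseteq> ?L"
    proof (safe)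
      fix \<omega> assume "\<omega> \<in> lattice (\<tau> / c)"
      then obtain m n where \<omega>: "\<omega> = of_int m + of_int n * (\<tau> / c)" by (auto simp: lattice_def)
      have "\<omega> * c = of_int m * c + of_int n * \<tau>" using c0 by (simp add: \<omega> field_simps)
      also have "\<dots> = of_int m + of_int (n + 2 * int k * m) * \<tau>" by (simp add: c_def algebra_simps)
      finally show "\<omega> * c \<in> ?L" by (simp only: L)
    qed
  qed (use c0 in auto)
  have fc: "g (\<omega> / c) = c ^ 2 * f \<omega>" for \<omega>
  proof -
    have "1 / 2 - \<omega> / c = (c / 2 - \<omega>) / c" using c0 by (simp add: field_simps)
    then show ?thesis by (simp add: f_def g_def power_divide right_diff_distrib)
  qed
  have "(\<lambda>\<omega>. g (\<omega> / c)) summable_on ?L"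
    using wp_half_summable[OF im'] summable_on_reindex_bij_betw[OF bij, of g] by (simp add: g_def)
  then have fs: "f summable_on ?L" unfolding fc using c0 by (simp add: summable_on_cmult_right')
  have gs: "g summable_on ?L" using wp_half_summable[OF im] by (simp add: g_def)
  have "wp (\<tau> / c) (1/2) = infsum g (lattice (\<tau> / c))"
    unfolding wp_half_infsum[OF im'] g_def ..
  also have "\<dots> = infsum (\<lambda>\<omega>. g (\<omega> / c)) ?L" by (rule infsum_reindex_bij_betw[OF bij, symmetric])
  also have "\<dots> = c ^ 2 * infsum f ?L" unfolding fc by (rule infsum_cmult_right')
  also have "infsum f ?L = infsum g ?L"
  proof -
    let ?s = "of_nat k * \<tau>"
    have shift: "bij_betw (\<lambda>\<omega>. \<omega> + ?s) ?L ?L"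
    proof (rule bij_betw_byWitness[of _ "\<lambda>\<omega>. \<omega> - ?s"])
      show "(\<lambda>\<omega>. \<omega> + ?s) ` ?L \<subseteq> ?L"
      proof (safe)
        fix \<omega> assume "\<omega> \<in> ?L"
        then obtain m n where "\<omega> = of_int m + of_int n * \<tau>" by (auto simp: lattice_def)
        then have "\<omega> + ?s = of_int m + of_int (n + int k) * \<tau>" by (simp add: algebra_simps)
        then show "\<omega> + ?s \<in> ?L" by (simp only: L)
      qed
      show "(\<lambda>\<omega>. \<omega> - ?s) ` ?L \<subseteq> ?L"
      proof (safe)
        fix \<omega> assume "\<omega> \<in> ?L"
        then obtain m n where "\<omega> = of_int m + of_int n * \<tau>" by (auto simp: lattice_def)
        then have "\<omega> - ?s = of_int m + of_int (n - int k) * \<tau>" by (simp add: algebra_simps)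
        then show "\<omega> - ?s \<in> ?L" by (simp only: L)
      qed
    qed auto
    \<comment> \<open>The reflection in the midpoint of \<open>0\<close> and \<open>- k \<tau>\<close> exchanges the two poles of the difference \<open>d\<close>
      below and changes its sign, so that its sum vanishes.\<close>
    have neg: "bij_betw (\<lambda>\<omega>. - \<omega> - ?s) ?L ?L"
    proof (rule bij_betw_byWitness[of _ "\<lambda>\<omega>. - \<omega> - ?s"])
      show "(\<lambda>\<omega>. - \<omega> - ?s) ` ?L \<subseteq> ?L"
      proof (safe)
        fix \<omega> assume "\<omega> \<in> ?L"
        then obtain m n where "\<omega> = of_int m + of_int n * \<tau>" by (auto simp: lattice_def)
        then have "- \<omega> - ?s = of_int (- m) + of_int (- n - int k) * \<tau>" by (simp add: algebra_simps)
        then show "- \<omega> - ?s \<in> ?L" by (simp only: L)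
      qed
      then show "(\<lambda>\<omega>. - \<omega> - ?s) ` ?L \<subseteq> ?L" .
    qed auto
    define d where "d = (\<lambda>\<omega>. f (\<omega> + ?s) - g \<omega>)"
    have d: "d \<omega> = 1 / \<omega> ^ 2 - 1 / (\<omega> + ?s) ^ 2" for \<omega>
    proof -
      have shift: "c / 2 - (\<omega> + ?s) = 1 / 2 - \<omega>" by (simp add: c_def field_simps)
      show ?thesis unfolding d_def f_def g_def shift by simp
    qed
    have fs': "(\<lambda>\<omega>. f (\<omega> + ?s)) summable_on ?L"
      using fs summable_on_reindex_bij_betw[OF shift, of f] by simp
    have "infsum d ?L = infsum (\<lambda>\<omega>. f (\<omega> + ?s)) ?L - infsum g ?L"
      unfolding d_def by (rule infsumI[OF has_sum_minus[OF has_sum_infsum[OF fs'] has_sum_infsum[OF gs]]])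
    also have "infsum (\<lambda>\<omega>. f (\<omega> + ?s)) ?L = infsum f ?L" by (rule infsum_reindex_bij_betw[OF shift])
    finally have diff: "infsum d ?L = infsum f ?L - infsum g ?L" .
    have "infsum d ?L = infsum (\<lambda>\<omega>. d (- \<omega> - ?s)) ?L" by (rule infsum_reindex_bij_betw[OF neg, symmetric])
    also have "(\<lambda>\<omega>. d (- \<omega> - ?s)) = (\<lambda>\<omega>. - d \<omega>)"
    proof
      fix \<omega>
      have "(- \<omega> - ?s) ^ 2 = (\<omega> + ?s) ^ 2" by (simp add: power2_eq_square algebra_simps)
      moreover have "- \<omega> - ?s + ?s = - \<omega>" by simp
      ultimately show "d (- \<omega> - ?s) = - d \<omega>" unfolding d by simp
    qed
    also have "infsum (\<lambda>\<omega>. - d \<omega>) ?L = - infsum d ?L" by (rule infsum_uminus)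
    finally have "infsum d ?L = 0" by simp
    with diff show ?thesis by simp
  qed
  also have "infsum g ?L = wp \<tau> (1/2)" unfolding wp_half_infsum[OF im] g_def ..
  finally show "mf_e (\<tau> / c) = c ^ 2 * mf_e \<tau>" by (simp add: mf_e_def)
qed

text \<open>
  Two of the roots determine the third because their sum is \<open>0\<close>, so the sum of squares gives \<open>a\<close> from two roots.
  This transfers the transformation behaviour of \<open>e\<close> to \<open>a\<close>.
\<close>

lemma a_from_roots:
  assumes "Im \<tau> > 0"
  shows "mf_a \<tau> = - (mf_e \<tau> ^ 2 - mf_e \<tau> * mf_e (\<tau> / 2) / 2 + mf_e (\<tau> / 2) ^ 2 / 4)"
proof -
  define x1 x2 x3 where "x1 = phi \<tau>" "x2 = - phi (\<tau> / 2) / 2" "x3 = - phi ((\<tau> + 1) / 2) / 2"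
  note r = roots_of_cubic(1,2)[OF assms, folded x1_x2_x3_def]
  have "2 * mf_a \<tau> = 2 * (- (x1 ^ 2 + x1 * x2 + x2 ^ 2))" using r by algebra
  then have "mf_a \<tau> = - (x1 ^ 2 + x1 * x2 + x2 ^ 2)"
    by (rule mult_left_cancel[THEN iffD1, rotated]) simp
  then show ?thesis
    using assms by (simp add: x1_x2_x3_def mf_e_eq_phi power2_eq_square)
qed

lemma mf_a_transform:
  fixes \<tau> :: complex and k :: nat
  assumes im: "Im \<tau> > 0"
  defines "c \<equiv> 2 * of_nat k * \<tau> + 1"
  shows "mf_a (\<tau> / c) = c ^ 4 * mf_a \<tau>"
proof -
  note e1 = mf_e_transform[OF im, of k, folded c_def]
  have "Im (\<tau> / 2) > 0" using im by simp
  moreover have "2 * of_nat (2 * k) * (\<tau> / 2) + 1 = c" by (simp add: c_def)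
  moreover have "\<tau> / 2 / c = \<tau> / c / 2" by simp
  ultimately have e2: "mf_e (\<tau> / c / 2) = c ^ 2 * mf_e (\<tau> / 2)"
    using mf_e_transform(1)[of "\<tau> / 2" "2 * k"] by (simp only:)
  show ?thesis
    unfolding a_from_roots[OF im] a_from_roots[OF e1(3)] e1(1) e2
    by (simp add: power2_eq_square power4_eq_xxxx algebra_simps)
qed

text \<open>
  An outer argument \<open>s\<close> that is itself a polynomial may be evaluated first.
\<close>

lemma poly_poly_eq: "poly (poly p s) t = poly (poly p [:poly s t:]) (t :: 'a :: comm_ring_1)"
  by (induction p) auto

lemma connected_finite_singleton:
  fixes A :: "'a::metric_space set"
  assumes "connected A" "finite A" "a \<in> A"
  shows "A = {a}"
  using assms by (auto simp: connected_finite_iff_sing)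

text \<open>
  As a function of the nome, \<open>a / e\<^sup>2\<close> is a constant times \<open>E\<^sub>4 / E2_level2\<^sup>2\<close> and is continuous near \<open>0\<close>. If it had only
  finitely many values it would be constant there, and then \<open>E\<^sub>4 = E2_level2\<^sup>2\<close>. But the coefficients
  of \<open>q\<close> are \<open>240\<close> and \<open>48\<close>.
\<close>

lemma infinite_ratios: "infinite {mf_a \<tau> / mf_e \<tau> ^ 2 | \<tau>. Im \<tau> > 0 \<and> mf_e \<tau> \<noteq> 0}" (is "infinite ?T")
proof
  assume fin: "finite ?T"
  have cont: "continuous_on (ball 0 1) (eval_fps f)" if "fps_conv_radius f \<ge> 1" for f :: "complex fps"
  proof (rule continuous_on_subset[OF continuous_on_eval_fps], safe)
    fix x :: complex assume "x \<in> ball 0 1"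
    then have "ereal (norm x) < 1" by simp
    from less_le_trans[OF this that] show "x \<in> eball 0 (fps_conv_radius f)" by simp
  qed
  have S0: "eval_fps E2_level2 0 = 1" by (simp add: eval_fps_at_0 E2_level2_odd lambert_def)
  have E0: "eval_fps E4 0 = 1" by (simp add: eval_fps_at_0 E4_def sigma_fps_def lambert_def)
  have "isCont (eval_fps E2_level2) 0"
    using cont[OF conv_radius_E(3)] by (simp add: continuous_on_eq_continuous_at)
  then have "\<forall>\<^sub>F q in nhds 0. eval_fps E2_level2 q \<noteq> 0"
    unfolding isCont_def tendsto_at_iff_tendsto_nhds
    by (rule tendsto_imp_eventually_ne) (simp add: S0)
  then obtain r0 where r0: "r0 > 0" "\<And>q. dist q 0 < r0 \<Longrightarrow> eval_fps E2_level2 q \<noteq> 0"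
    unfolding eventually_nhds_metric by blast
  then have "min r0 1 > 0 \<and> min r0 1 \<le> 1 \<and> (\<forall>q\<in>ball 0 (min r0 1). eval_fps E2_level2 q \<noteq> 0)"
    by (auto simp: dist_commute)
  then obtain r where r: "r > 0" "r \<le> 1" "\<And>q. q \<in> ball 0 r \<Longrightarrow> eval_fps E2_level2 q \<noteq> 0" by blast
  let ?R = "\<lambda>q. eval_fps E4 q / eval_fps E2_level2 q ^ 2"
  have sub: "?R ` ball 0 r \<subseteq> insert 1 ((\<lambda>t. - (4/3) * t) ` ?T)"
  proof (safe)
    fix q assume q: "q \<in> ball 0 r" "?R q \<notin> (\<lambda>t. - (4/3) * t) ` ?T"
    show "?R q = 1"
    proof (cases "q = 0")
      case True then show ?thesis by (simp add: S0 E0)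
    next
      case False
      define \<tau> where "\<tau> = - \<i> * Ln q / of_real (2 * pi)"
      have nome: "nome \<tau> = q" using False by (simp add: nome_def \<tau>_def)
      have "ln (norm q) < 0" using q r False by simp
      then have im: "Im \<tau> > 0" using False by (simp add: \<tau>_def Im_divide_of_real divide_neg_pos)
      have e: "mf_e \<tau> = - (2/3) * eval_fps E2_level2 q" using im by (simp add: mf_e_eq_phi phi_def nome)
      then have "mf_e \<tau> \<noteq> 0" using r(3)[OF q(1)] by simp
      then have "mf_a \<tau> / mf_e \<tau> ^ 2 \<in> ?T" using im by blast
      moreover have "?R q = - (4/3) * (mf_a \<tau> / mf_e \<tau> ^ 2)"
        unfolding e mf_a_eval[OF im] nome by (simp add: power2_eq_square field_simps)
      ultimately show ?thesis using q(2) by blast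
    qed
  qed
  have "connected (?R ` ball 0 r)"
    by (intro connected_continuous_image continuous_intros continuous_on_subset[OF cont])
       (use r conv_radius_E in auto)
  moreover have "finite (?R ` ball 0 r)" using sub fin by (rule finite_subset[OF _ finite.insertI[OF finite_imageI]])
  moreover have "?R 0 \<in> ?R ` ball 0 r" using r by auto
  moreover have "?R 0 = 1" by (simp add: S0 E0)
  ultimately have sing: "?R ` ball 0 r = {1}"
    by (metis connected_finite_singleton)
  have eq: "eval_fps E4 q = eval_fps (E2_level2 * E2_level2) q" if "q \<in> ball 0 r" for q
  proof -
    have "?R q \<in> ?R ` ball 0 r" using that by (rule imageI)
    then have "?R q = 1" unfolding sing by simp
    moreover have "norm q < 1" using that r by auto
    ultimately show ?thesis
      using r(3)[OF that] by (simp add: eval_combine conv_radius_E power2_eq_square)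
  qed
  have "E4 = E2_level2 * E2_level2"
  proof (rule eval_fps_eqD)
    show "fps_conv_radius E4 > 0" "fps_conv_radius (E2_level2 * E2_level2) > 0"
      using conv_radius_E(1) conv_radius_combine(3)[OF conv_radius_E(3,3)]
      by (auto intro: less_le_trans[of _ 1])
    show "\<forall>\<^sub>F q in nhds 0. eval_fps E4 q = eval_fps (E2_level2 * E2_level2) q"
      unfolding eventually_nhds_metric using eq r(1) by (auto simp: dist_commute)
  qed
  then have "fps_nth E4 1 = fps_nth (E2_level2 * E2_level2) 1" by simp
  moreover have "{d. d = Suc 0} = {1}" by auto
  ultimately show False
    by (simp add: E4_def E2_level2_odd sigma_fps_def lambert_def fps_mult_nth numeral_fps_const)
qed

text \<open>
  The relation holds at \<open>(c\<^sup>4 a, c\<^sup>2 e)\<close> for the infinitely many \<open>c = 2 k \<tau> + 1\<close>, hence for every complex \<open>c\<close>. Choosing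
  \<open>c\<^sup>2 = y / e\<close> turns the point into \<open>(y\<^sup>2 t, y)\<close> with \<open>t = a / e\<^sup>2\<close>. Here \<open>y\<close> is arbitrary and \<open>t\<close> ranges
  over an infinite set.
\<close>

theorem a_e_algebraically_independent:
  fixes G :: "complex poly poly"
  assumes G: "\<And>\<tau>. Im \<tau> > 0 \<Longrightarrow> poly (poly G [:mf_e \<tau>:]) (mf_a \<tau>) = 0"
  shows "G = 0"
proof -
  have scale: "poly (poly G [:c ^ 2 * mf_e \<tau>:]) (c ^ 4 * mf_a \<tau>) = 0" if im: "Im \<tau> > 0" for c \<tau>
  proof -
    have "\<exists>P. \<forall>c. poly P c = poly (poly G [:c ^ 2 * mf_e \<tau>:]) (c ^ 4 * mf_a \<tau>)"
    proof (induction G)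
      case 0
      then show ?case by (auto intro: exI[of _ 0])
    next
      case (pCons p G)
      then obtain P where P: "\<And>c. poly P c = poly (poly G [:c ^ 2 * mf_e \<tau>:]) (c ^ 4 * mf_a \<tau>)" by blast
      have "poly (pcompose p (monom (mf_a \<tau>) 4) + monom (mf_e \<tau>) 2 * P) c
          = poly (poly (pCons p G) [:c ^ 2 * mf_e \<tau>:]) (c ^ 4 * mf_a \<tau>)" for c
        by (simp add: poly_pcompose poly_monom P algebra_simps)
      then show ?case by blast
    qed
    then obtain P where P: "\<And>c. poly P c = poly (poly G [:c ^ 2 * mf_e \<tau>:]) (c ^ 4 * mf_a \<tau>)" by blast
    have "poly P (2 * of_nat k * \<tau> + 1) = 0" for k
      unfolding P using G[OF mf_e_transform(3)[OF im, of k]]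
      by (simp only: mf_e_transform(1)[OF im] mf_a_transform[OF im])
    then have "range (\<lambda>k. 2 * of_nat k * \<tau> + 1) \<subseteq> {c. poly P c = 0}" by blast
    moreover have "inj (\<lambda>k. 2 * of_nat k * \<tau> + 1 :: complex)"
    proof -
      have "\<tau> \<noteq> 0" using im by auto
      then show ?thesis by (auto simp: inj_on_def)
    qed
    then have "infinite (range (\<lambda>k. 2 * of_nat k * \<tau> + 1 :: complex))" by (rule range_inj_infinite)
    ultimately have "P = 0" using poly_roots_finite finite_subset by blast
    then show ?thesis using P[of c] by simp
  qed
  have "poly G [:y:] = 0" if y: "y \<noteq> 0" for y
  proof -
    let ?T = "{mf_a \<tau> / mf_e \<tau> ^ 2 | \<tau>. Im \<tau> > 0 \<and> mf_e \<tau> \<noteq> 0}"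
    have "poly (poly G [:y:]) (y ^ 2 * t) = 0" if "t \<in> ?T" for t
    proof -
      from that obtain \<tau> where \<tau>: "Im \<tau> > 0" "mf_e \<tau> \<noteq> 0" "t = mf_a \<tau> / mf_e \<tau> ^ 2" by blast
      define c where "c = csqrt (y / mf_e \<tau>)"
      have c2: "c ^ 2 = y / mf_e \<tau>" by (simp add: c_def)
      have "c ^ 4 = (c ^ 2) ^ 2" by (simp flip: power_mult)
      then have "c ^ 4 * mf_a \<tau> = y ^ 2 * t" by (simp add: c2 \<tau>(3) power_divide)
      moreover have "c ^ 2 * mf_e \<tau> = y" using \<tau> by (simp add: c2)
      ultimately show ?thesis using scale[OF \<tau>(1), of c] by simp
    qed
    then have "(\<lambda>t. y ^ 2 * t) ` ?T \<subseteq> {x. poly (poly G [:y:]) x = 0}" by blast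
    moreover have "infinite ((\<lambda>t. y ^ 2 * t) ` ?T)"
      using infinite_ratios y by (subst finite_image_iff) (auto simp: inj_on_def)
    ultimately show ?thesis using poly_roots_finite finite_subset by blast
  qed
  then have "(\<lambda>y. [:y:]) ` (- {0}) \<subseteq> {x. poly G x = 0}" by blast
  moreover have "infinite ((\<lambda>y::complex. [:y:]) ` (- {0}))"
    by (subst finite_image_iff) (auto simp: inj_on_def infinite_UNIV_char_0 Compl_eq_Diff_UNIV)
  ultimately show ?thesis using poly_roots_finite finite_subset by blast
qed

text \<open>
  The degrees of the nonzero summands are pairwise incongruent modulo 3, so no cancellation of leading terms is possible.
\<close>

lemma sum_shifted_zero:
  fixes f g h :: "'a :: idom poly"
  assumes "f + pCons 0 g + pCons 0 (pCons 0 h) = 0"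
    and "3 dvd degree f" "3 dvd degree g" "3 dvd degree h"
  shows "f = 0 \<and> g = 0 \<and> h = 0"
proof -
  let ?g = "pCons 0 g" and ?h = "pCons 0 (pCons 0 h)"
  have f: "f = - (?g + ?h)" using assms(1) by (metis add.assoc eq_neg_iff_add_eq_0)
  have mods: "degree f mod 3 = 0" "g \<noteq> 0 \<Longrightarrow> degree ?g mod 3 = 1" "h \<noteq> 0 \<Longrightarrow> degree ?h mod 3 = 2"
    using assms(2-4) by (auto simp: degree_pCons_eq mod_Suc)
  show ?thesis
  proof (cases "g = 0"; cases "h = 0")
    assume "g = 0" "h = 0" then show ?thesis using f by simp
  next
    assume "g = 0" "h \<noteq> 0"
    then have "degree f = degree ?h" by (simp add: f)
    with mods \<open>h \<noteq> 0\<close> show ?thesis by simp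
  next
    assume "g \<noteq> 0" "h = 0"
    then have "degree f = degree ?g" by (simp add: f)
    with mods \<open>g \<noteq> 0\<close> show ?thesis by simp
  next
    assume gh: "g \<noteq> 0" "h \<noteq> 0"
    have "degree ?g \<noteq> degree ?h" using mods gh by fastforce
    then consider "degree ?g < degree ?h" | "degree ?h < degree ?g" by linarith
    then have "degree (?g + ?h) = degree ?h \<or> degree (?g + ?h) = degree ?g"
      by cases (simp_all only: degree_add_eq_right degree_add_eq_left simp_thms)
    then have "degree f = degree ?h \<or> degree f = degree ?g" by (simp only: f degree_minus)
    with mods gh show ?thesis by fastforce
  qed
qed

text \<open>
  Substituting \<open>b = - y\<^sup>3 - a y\<close> turns a relation into a polynomial in \<open>a\<close> and \<open>y = e\<close>. The substitution
  multiplies the degree in the outer variable by 3.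
\<close>

theorem basis_independent:
  assumes rel: "\<And>\<tau>. Im \<tau> > 0 \<Longrightarrow> eval_ab p0 \<tau> + eval_ab p1 \<tau> * mf_e \<tau> + eval_ab p2 \<tau> * mf_e \<tau> ^ 2 = 0"
  shows "p0 = 0 \<and> p1 = 0 \<and> p2 = 0"
proof -
  define r :: ring_ab where "r = [:0, - [:0, 1:], 0, - 1:]"
  have deg: "degree r = 3" by (simp add: r_def)
  have ev: "poly (poly (pcompose p r) [:mf_e \<tau>:]) (mf_a \<tau>) = eval_ab p \<tau>" if "Im \<tau> > 0" for p \<tau>
  proof -
    have "poly (poly r [:mf_e \<tau>:]) (mf_a \<tau>) = - (mf_e \<tau> ^ 3 + mf_a \<tau> * mf_e \<tau>)"
      by (simp add: r_def algebra_simps power3_eq_cube)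
    also have "\<dots> = mf_b \<tau>" using cubic[OF that] unfolding mf_e_eq_phi[OF that] by algebra
    finally show ?thesis unfolding eval_ab_def poly_pcompose by (subst poly_poly_eq) simp
  qed
  have "pcompose p0 r + pCons 0 (pcompose p1 r) + pCons 0 (pCons 0 (pcompose p2 r)) = 0"
  proof (rule a_e_algebraically_independent)
    fix \<tau> assume "Im \<tau> > 0"
    then show "poly (poly (pcompose p0 r + pCons 0 (pcompose p1 r) + pCons 0 (pCons 0 (pcompose p2 r)))
        [:mf_e \<tau>:]) (mf_a \<tau>) = 0"
      using rel[of \<tau>] by (simp add: ev algebra_simps power2_eq_square)
  qed
  then have "pcompose p0 r = 0 \<and> pcompose p1 r = 0 \<and> pcompose p2 r = 0"
    by (rule sum_shifted_zero) (simp_all add: degree_pcompose deg)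
  then show ?thesis using deg by (auto simp: pcompose_eq_0_iff)
qed

section \<open>The regular representation and the generating function\<close>

lemma matrix_inv_eqI:
  fixes A B :: "'a::comm_ring_1 ^ 'n ^ 'n"
  assumes "A ** B = mat 1" "B ** A = mat 1"
  shows "matrix_inv A = B"
proof -
  have "A ** matrix_inv A = mat 1 \<and> matrix_inv A ** A = mat 1"
    unfolding matrix_inv_def by (rule someI[of _ B]) (use assms in simp)
  then have "matrix_inv A = matrix_inv A ** (A ** B)" "(matrix_inv A ** A) ** B = B"
    using assms by simp_all
  then show ?thesis by (simp add: matrix_mul_assoc)
qed

primrec mpow :: "'a::comm_ring_1 ^ 'n ^ 'n \<Rightarrow> nat \<Rightarrow> 'a ^ 'n ^ 'n" where
  "mpow N 0 = mat 1"
| "mpow N (Suc k) = N ** mpow N k"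

lemma mpow_commute: "mpow N k ** N = N ** mpow N k"
  by (induction k) (simp_all add: matrix_mul_assoc[symmetric])

definition const_mat :: "'a::comm_ring_1 ^ 'n ^ 'n \<Rightarrow> 'a fps ^ 'n ^ 'n" where
  "const_mat N = (\<chi> i j. fps_const (N $ i $ j))"

lemma fps_const_sum: "fps_const (\<Sum>i\<in>I. f i) = (\<Sum>i\<in>I. fps_const (f i :: 'a::comm_ring_1))"
  by (induction I rule: infinite_finite_induct) (simp_all flip: fps_const_add)

lemma const_mat_mult: "const_mat (M ** N) = const_mat M ** const_mat N"
  by (simp add: const_mat_def matrix_matrix_mult_def vec_eq_iff fps_const_sum flip: fps_const_mult)

lemma const_mat_diff: "const_mat (M - N) = const_mat M - const_mat N"
  by (simp add: const_mat_def vec_eq_iff)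

lemma const_mat_mat: "const_mat (mat x) = mat (fps_const x)"
  by (simp add: const_mat_def mat_def vec_eq_iff)

lemma const_mat_mpow: "const_mat (mpow N k) = mpow (const_mat N) k"
  by (induction k) (simp_all add: const_mat_mat const_mat_mult)

text \<open>
  The series \<open>\<Sum>\<^sub>k N\<^sup>k X\<^sup>k\<close>.
\<close>

definition geometric :: "'a::comm_ring_1 ^ 'n ^ 'n \<Rightarrow> 'a fps ^ 'n ^ 'n" where
  "geometric N = (\<chi> i j. Abs_fps (\<lambda>k. mpow N k $ i $ j))"

lemma mat_mult_nth: "(mat x ** M) $ i $ j = x * (M $ i $ j)" for M :: "'a::comm_ring_1 ^ 'n ^ 'm"
  by (simp add: matrix_matrix_mult_def mat_def if_distrib if_distribR sum.delta cong: if_cong)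

lemma matrix_mult_nth: "(A ** B) $ i $ j = (\<Sum>l\<in>UNIV. A $ i $ l * B $ l $ j)"
  by (simp add: matrix_matrix_mult_def)

lemma geometric_inverse:
  fixes N :: "'a::comm_ring_1 ^ 'n ^ 'n"
  defines "M \<equiv> mat 1 - mat fps_X ** const_mat N"
  shows "M ** geometric N = mat 1" "geometric N ** M = mat 1"
proof -
  have mult_diff: "(P - Q) ** R = P ** R - Q ** R" "R ** (P - Q) = R ** P - R ** Q"
    for P Q R :: "'b::comm_ring_1 ^ 'n ^ 'n"
    by (simp_all add: matrix_matrix_mult_def vec_eq_iff algebra_simps sum_subtractf)
  have L: "(const_mat N ** geometric N) $ i $ j = Abs_fps (\<lambda>k. mpow N (Suc k) $ i $ j)" for i j
    by (rule fps_ext) (simp add: const_mat_def geometric_def matrix_matrix_mult_def fps_sum_nth)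
  have R: "(geometric N ** const_mat N) $ i $ j = Abs_fps (\<lambda>k. mpow N (Suc k) $ i $ j)" for i j
    unfolding mpow.simps mpow_commute[symmetric]
    by (rule fps_ext) (simp add: const_mat_def geometric_def matrix_matrix_mult_def fps_sum_nth)
  have *: "geometric N $ i $ j - fps_X * Abs_fps (\<lambda>k. mpow N (Suc k) $ i $ j) = mat 1 $ i $ j" for i j
  proof (rule fps_ext)
    fix k
    show "fps_nth (geometric N $ i $ j - fps_X * Abs_fps (\<lambda>k. mpow N (Suc k) $ i $ j)) k
        = fps_nth (mat 1 $ i $ j) k"
      by (cases k) (simp_all add: geometric_def mat_def)
  qed
  show "M ** geometric N = mat 1"
    unfolding vec_eq_iff
  proof (intro allI)
    fix i j
    have "(M ** geometric N) $ i $ j = geometric N $ i $ j - (mat fps_X ** (const_mat N ** geometric N)) $ i $ j"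
      by (simp add: M_def mult_diff matrix_mul_assoc)
    then show "(M ** geometric N) $ i $ j = mat 1 $ i $ j"
      unfolding mat_mult_nth L * .
  qed
  have comm: "P ** (mat x ** Q) = mat x ** (P ** Q)" for P Q :: "'a fps ^ 'n ^ 'n" and x
    unfolding vec_eq_iff
  proof (intro allI)
    fix i j
    have "(P ** (mat x ** Q)) $ i $ j = (\<Sum>l\<in>UNIV. P $ i $ l * (mat x ** Q) $ l $ j)"
      by (rule matrix_mult_nth)
    also have "\<dots> = x * (\<Sum>l\<in>UNIV. P $ i $ l * Q $ l $ j)"
      unfolding mat_mult_nth by (simp add: sum_distrib_left mult_ac)
    also have "\<dots> = (mat x ** (P ** Q)) $ i $ j"
      by (simp only: mat_mult_nth[where M = "P ** Q"] matrix_mult_nth[of P Q])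
    finally show "(P ** (mat x ** Q)) $ i $ j = (mat x ** (P ** Q)) $ i $ j" .
  qed
  show "geometric N ** M = mat 1"
    unfolding vec_eq_iff
  proof (intro allI)
    fix i j
    have "(geometric N ** M) $ i $ j = geometric N $ i $ j - (mat fps_X ** (geometric N ** const_mat N)) $ i $ j"
      by (simp add: M_def mult_diff comm)
    then show "(geometric N ** M) $ i $ j = mat 1 $ i $ j"
      unfolding mat_mult_nth R * .
  qed
qed

text \<open>
  The variable \<open>A\<close> is the outer one and \<open>B\<close> lives in the coefficients. So the inverse of the first factor is a geometric
  series over \<open>\<complex>[a,b][[B]]\<close>, and the inverse of the second is one over \<open>\<complex>[a,b]\<close> with constants embedded.
\<close>

lemma inverse_product_coeff:
  fixes N1 N2 :: "ring_ab ^ 3 ^ 3"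
  defines "M \<equiv> (mat 1 - mat vA ** emb_mat N1) ** (mat 1 - mat vB ** emb_mat N2)"
  shows "fps_nth (fps_nth (trace (matrix_inv M)) i) j = trace (mpow N2 j ** mpow N1 i)"
proof -
  have emb: "emb_mat N = const_mat (const_mat N)" for N
    by (simp add: emb_mat_def const_mat_def emb_def)
  let ?X = "geometric (const_mat N1)" and ?Y = "const_mat (geometric N2)"
  let ?P = "mat 1 - mat vA ** emb_mat N1" and ?Q = "mat 1 - mat vB ** emb_mat N2"
  have P: "?P ** ?X = mat 1" "?X ** ?P = mat 1"
    unfolding emb vA_def by (rule geometric_inverse)+
  have "?Q = const_mat (mat 1 - mat fps_X ** const_mat N2)"
    by (simp add: emb vB_def const_mat_diff const_mat_mult const_mat_mat)
  then have Q: "?Q ** ?Y = mat 1" "?Y ** ?Q = mat 1"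
    by (simp_all add: const_mat_mult[symmetric] geometric_inverse const_mat_mat)
  have "M ** (?Y ** ?X) = ?P ** (?Q ** ?Y) ** ?X" by (simp add: M_def matrix_mul_assoc)
  moreover have "(?Y ** ?X) ** M = ?Y ** (?X ** ?P) ** ?Q" by (simp add: M_def matrix_mul_assoc)
  ultimately have "matrix_inv M = ?Y ** ?X"
    by (intro matrix_inv_eqI) (simp_all add: P Q)
  then show ?thesis
    by (simp add: trace_def matrix_matrix_mult_def fps_sum_nth const_mat_def[of "geometric _"]
        geometric_def const_mat_mpow[symmetric]) (simp add: const_mat_def geometric_def)
qed

text \<open>
  Multiplication by \<open>u + v e + w e\<^sup>2\<close> in the basis \<open>1, e, e\<^sup>2\<close>, where \<open>e\<^sup>3 = - a e - b\<close>.
\<close>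

definition regular_rep :: "'a::comm_ring_1 \<Rightarrow> 'a \<Rightarrow> 'a \<Rightarrow> 'a \<Rightarrow> 'a \<Rightarrow> 'a ^ 3 ^ 3" where
  "regular_rep a b u v w = vector
     [vector [u, - b * w, - b * v],
      vector [v, u - a * w, - a * v - b * w],
      vector [w, v, u - a * w]]"

lemma regular_rep_mult:
  "regular_rep a b u v w ** regular_rep a b u' v' w' =
     regular_rep a b (u * u' - b * (v * w' + w * v'))
       (u * v' + v * u' - a * (v * w' + w * v') - b * (w * w'))
       (u * w' + v * v' + w * u' - a * (w * w'))"
  by (simp add: regular_rep_def matrix_matrix_mult_def vec_eq_iff forall_3 sum_3 vector_3 algebra_simps)

lemma regular_rep_one: "mat 1 = regular_rep a b 1 0 0"
  by (simp add: regular_rep_def mat_def vec_eq_iff forall_3 vector_3)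

text \<open>
  The traces of \<open>1\<close>, \<open>e\<close>, \<open>e\<^sup>2\<close> are \<open>3\<close>, \<open>0\<close>, \<open>- 2 a\<close>, the power sums of the roots of \<open>x\<^sup>3 + a x + b\<close>.
\<close>

lemma trace_regular_rep: "trace (regular_rep a b u v w) = 3 * u - 2 * a * w"
  by (simp add: regular_rep_def trace_def sum_3 vector_3 algebra_simps)

definition pa :: ring_ab where "pa = [:[:0, 1:]:]"
definition pb :: ring_ab where "pb = [:0, 1:]"

lemma eval_ab_simps [simp]:
  "eval_ab (P + Q) \<tau> = eval_ab P \<tau> + eval_ab Q \<tau>"
  "eval_ab (P - Q) \<tau> = eval_ab P \<tau> - eval_ab Q \<tau>"
  "eval_ab (- P) \<tau> = - eval_ab P \<tau>"
  "eval_ab (P * Q) \<tau> = eval_ab P \<tau> * eval_ab Q \<tau>"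
  "eval_ab 0 \<tau> = 0" "eval_ab 1 \<tau> = 1" "eval_ab (numeral k) \<tau> = numeral k"
  "eval_ab pa \<tau> = mf_a \<tau>" "eval_ab pb \<tau> = mf_b \<tau>" "eval_ab [:[:c:]:] \<tau> = c"
  by (simp_all add: eval_ab_def pa_def pb_def)

text \<open>
  The matrix \<open>N\<close> is multiplication by an element \<open>u + v e + w e\<^sup>2\<close>, and \<open>h \<tau> x\<close> is the value of this element when \<open>e\<close> is
  replaced by a root \<open>x\<close> of the cubic at \<open>\<tau>\<close>. Products of matrices correspond to products of values.
\<close>

definition represents :: "ring_ab ^ 3 ^ 3 \<Rightarrow> (complex \<Rightarrow> complex \<Rightarrow> complex) \<Rightarrow> bool" where
  "represents N h \<longleftrightarrow> (\<exists>u v w. N = regular_rep pa pb u v w \<and>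
     (\<forall>\<tau> x. x ^ 3 + mf_a \<tau> * x + mf_b \<tau> = 0 \<longrightarrow> eval_ab u \<tau> + eval_ab v \<tau> * x + eval_ab w \<tau> * x ^ 2 = h \<tau> x))"

lemma represents_mult:
  assumes "represents M g" "represents N h"
  shows "represents (M ** N) (\<lambda>\<tau> x. g \<tau> x * h \<tau> x)"
proof -
  from assms obtain u v w u' v' w' where M: "M = regular_rep pa pb u v w" and N: "N = regular_rep pa pb u' v' w'"
    and g: "\<And>\<tau> x. x ^ 3 + mf_a \<tau> * x + mf_b \<tau> = 0 \<Longrightarrow> eval_ab u \<tau> + eval_ab v \<tau> * x + eval_ab w \<tau> * x ^ 2 = g \<tau> x"
    and h: "\<And>\<tau> x. x ^ 3 + mf_a \<tau> * x + mf_b \<tau> = 0 \<Longrightarrow> eval_ab u' \<tau> + eval_ab v' \<tau> * x + eval_ab w' \<tau> * x ^ 2 = h \<tau> x"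
    unfolding represents_def by blast
  show ?thesis
    unfolding represents_def M N regular_rep_mult
  proof (intro exI conjI allI impI, rule refl)
    fix \<tau> x assume x: "x ^ 3 + mf_a \<tau> * x + mf_b \<tau> = 0"
    show "eval_ab (u * u' - pb * (v * w' + w * v')) \<tau>
        + eval_ab (u * v' + v * u' - pa * (v * w' + w * v') - pb * (w * w')) \<tau> * x
        + eval_ab (u * w' + v * v' + w * u' - pa * (w * w')) \<tau> * x ^ 2 = g \<tau> x * h \<tau> x"
      unfolding g[OF x, symmetric] h[OF x, symmetric] eval_ab_simps using x by algebra
  qed
qed

lemma represents_mpow:
  assumes "represents N h"
  shows "represents (mpow N k) (\<lambda>\<tau> x. h \<tau> x ^ k)"
proof (induction k)
  case 0
  have "mat 1 = regular_rep pa pb 1 0 0" by (rule regular_rep_one)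
  then show ?case unfolding represents_def mpow.simps by (intro exI[of _ 1] exI[of _ 0]) auto
next
  case (Suc k)
  from represents_mult[OF assms Suc] show ?case by simp
qed

text \<open>
  Both sides are linear in the element, and for \<open>1\<close>, \<open>e\<close>, \<open>e\<^sup>2\<close> they agree by the power sums in \<open>roots_of_cubic\<close>.
\<close>

lemma trace_represents:
  assumes N: "represents N h" and im: "Im \<tau> > 0"
  shows "eval_ab (trace N) \<tau> = h \<tau> (phi \<tau>) + h \<tau> (- phi (\<tau> / 2) / 2) + h \<tau> (- phi ((\<tau> + 1) / 2) / 2)"
proof -
  define x1 x2 x3 where defs: "x1 = phi \<tau>" "x2 = - phi (\<tau> / 2) / 2" "x3 = - phi ((\<tau> + 1) / 2) / 2"
  note r = roots_of_cubic(1-3)[OF im, folded defs]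
  from N obtain u v w where "N = regular_rep pa pb u v w"
    and h: "\<And>x. x ^ 3 + mf_a \<tau> * x + mf_b \<tau> = 0 \<Longrightarrow> h \<tau> x = eval_ab u \<tau> + eval_ab v \<tau> * x + eval_ab w \<tau> * x ^ 2"
    unfolding represents_def by metis
  then have "eval_ab (trace N) \<tau> = 3 * eval_ab u \<tau> - 2 * mf_a \<tau> * eval_ab w \<tau>"
    by (simp add: trace_regular_rep)
  also have "\<dots> = 3 * eval_ab u \<tau> + eval_ab v \<tau> * (x1 + x2 + x3) + eval_ab w \<tau> * (x1 ^ 2 + x2 ^ 2 + x3 ^ 2)"
    unfolding r(1,2) by simp
  also have "\<dots> = h \<tau> x1 + h \<tau> x2 + h \<tau> x3"
    using h[OF r(3)] by (simp add: algebra_simps)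
  finally show ?thesis by (simp add: defs)
qed

lemma as_poly_eqI:
  assumes "\<And>\<tau>. Im \<tau> > 0 \<Longrightarrow> eval_ab P \<tau> = f \<tau>"
  shows "as_poly f = P"
  unfolding as_poly_def
proof (rule the_equality)
  show "\<forall>\<tau>. 0 < Im \<tau> \<longrightarrow> eval_ab P \<tau> = f \<tau>" using assms by blast
  fix Q assume Q: "\<forall>\<tau>. 0 < Im \<tau> \<longrightarrow> eval_ab Q \<tau> = f \<tau>"
  have "Q - P = 0 \<and> (0::ring_ab) = 0 \<and> (0::ring_ab) = 0"
    by (rule basis_independent) (use Q assms in simp)
  then show "Q = P" by simp
qed

lemma rho_eqI:
  assumes "\<And>\<tau>. Im \<tau> > 0 \<Longrightarrow> f \<tau> = eval_ab u \<tau> + eval_ab v \<tau> * mf_e \<tau> + eval_ab w \<tau> * mf_e \<tau> ^ 2"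
  shows "rho f = regular_rep pa pb u v w"
  unfolding rho_def
proof (rule the_equality)
  show "\<forall>\<tau>. 0 < Im \<tau> \<longrightarrow> (\<forall>j. f \<tau> * basis_e \<tau> $ j
      = (\<Sum>i\<in>UNIV. eval_ab (regular_rep pa pb u v w $ i $ j) \<tau> * basis_e \<tau> $ i))"
  proof (intro allI impI)
    fix \<tau> :: complex and j :: 3 assume im: "Im \<tau> > 0"
    have c: "mf_e \<tau> ^ 3 + mf_a \<tau> * mf_e \<tau> + mf_b \<tau> = 0"
      using cubic[OF im] by (simp add: mf_e_eq_phi[OF im])
    have "\<forall>j. f \<tau> * basis_e \<tau> $ j = (\<Sum>i\<in>UNIV. eval_ab (regular_rep pa pb u v w $ i $ j) \<tau> * basis_e \<tau> $ i)"
      unfolding forall_3 sum_3 regular_rep_def basis_e_def vector_3 eval_ab_simps assms[OF im]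
      using c by (intro conjI) algebra+
    then show "f \<tau> * basis_e \<tau> $ j = (\<Sum>i\<in>UNIV. eval_ab (regular_rep pa pb u v w $ i $ j) \<tau> * basis_e \<tau> $ i)" ..
  qed
  note ok = this
  fix N assume N: "\<forall>\<tau>. 0 < Im \<tau> \<longrightarrow> (\<forall>j. f \<tau> * basis_e \<tau> $ j
      = (\<Sum>i\<in>UNIV. eval_ab (N $ i $ j) \<tau> * basis_e \<tau> $ i))"
  show "N = regular_rep pa pb u v w"
    unfolding vec_eq_iff
  proof (intro allI)
    fix i j :: 3
    let ?d = "\<lambda>i. N $ i $ j - regular_rep pa pb u v w $ i $ j"
    have "?d 1 = 0 \<and> ?d 2 = 0 \<and> ?d 3 = 0"
    proof (rule basis_independent)
      fix \<tau> :: complex assume im: "Im \<tau> > 0"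
      have "(\<Sum>i\<in>UNIV. eval_ab (N $ i $ j) \<tau> * basis_e \<tau> $ i)
          = (\<Sum>i\<in>UNIV. eval_ab (regular_rep pa pb u v w $ i $ j) \<tau> * basis_e \<tau> $ i)"
        using trans[OF N[rule_format, OF im, of j, symmetric] ok[rule_format, OF im, of j]] .
      then show "eval_ab (?d 1) \<tau> + eval_ab (?d 2) \<tau> * mf_e \<tau> + eval_ab (?d 3) \<tau> * mf_e \<tau> ^ 2 = 0"
        by (simp add: sum_3 basis_e_def vector_3 algebra_simps)
    qed
    then have "\<forall>i. ?d i = 0" by (simp add: forall_3)
    then show "N $ i $ j = regular_rep pa pb u v w $ i $ j" by simp
  qed
qed

lemma rho_a: "rho (level2 4 mf_a) = regular_rep pa pb (- 4 * pa) 0 (- 15)"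
  by (rule rho_eqI) (simp add: level2_def a_double mf_e_eq_phi)

lemma rho_b: "rho (level2 6 mf_b) = regular_rep pa pb (22 * pb) (14 * pa) 0"
  by (rule rho_eqI) (simp add: level2_def b_double mf_e_eq_phi)

lemma emb_simps:
  "emb (P + Q) = emb P + emb Q" "emb (P - Q) = emb P - emb Q" "emb (- P) = - emb P" "emb (P * Q) = emb P * emb Q"
  "emb 0 = 0" "emb 1 = 1" "emb (numeral k) = numeral k"
  by (simp_all add: emb_def numeral_fps_const)

lemma emb_pa_pb: "emb pa = va" "emb pb = vb"
  by (simp_all add: pa_def pb_def va_def vb_def)

lemma mat_1_nth: "mat 1 $ i $ j = (if i = j then 1 else 0)"
  by (simp add: mat_def)

lemma M1_eq: "mat 1 - mat vA ** emb_mat (rho (level2 4 mf_a)) = M1"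
  by (simp add: rho_a M1_def regular_rep_def vec_eq_iff forall_3 mat_mult_nth emb_mat_def vector_3 emb_simps
      emb_pa_pb mat_1_nth algebra_simps)

lemma M2_eq: "mat 1 - mat vB ** emb_mat (rho (level2 6 mf_b)) = M2"
  by (simp add: rho_b M2_def regular_rep_def vec_eq_iff forall_3 mat_mult_nth emb_mat_def vector_3 emb_simps
      emb_pa_pb mat_1_nth algebra_simps power2_eq_square)

text \<open>
  The three terms of \<open>T\<^sub>2 (a\<^sup>i b\<^sup>j)\<close> are the values of \<open>a'\<^sup>i b'\<^sup>j\<close> at the three roots. Their sum is a trace, and the
  weight \<open>4 i + 6 j\<close> distributes over the factors as \<open>16\<^sup>i 64\<^sup>j\<close>.
\<close>

lemma hecke_monomial:
  "as_poly (T2 (4 * i + 6 * j) (\<lambda>\<tau>. mf_a \<tau> ^ i * mf_b \<tau> ^ j))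
     = [:[:1/2:]:] * trace (mpow (rho (level2 6 mf_b)) j ** mpow (rho (level2 4 mf_a)) i)"
proof (rule as_poly_eqI)
  fix \<tau> :: complex assume im: "Im \<tau> > 0"
  let ?f = "\<lambda>\<tau> x. - 4 * mf_a \<tau> - 15 * x ^ 2" and ?g = "\<lambda>\<tau> x. 22 * mf_b \<tau> + 14 * mf_a \<tau> * x"
  have "represents (rho (level2 4 mf_a)) ?f"
    unfolding rho_a represents_def by (intro exI conjI, rule refl) simp
  moreover have "represents (rho (level2 6 mf_b)) ?g"
    unfolding rho_b represents_def by (intro exI conjI, rule refl) simp
  ultimately have "represents (mpow (rho (level2 6 mf_b)) j ** mpow (rho (level2 4 mf_a)) i)
      (\<lambda>\<tau> x. ?g \<tau> x ^ j * ?f \<tau> x ^ i)"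
    by (intro represents_mult represents_mpow)
  note tr = trace_represents[OF this im]
  note roots = roots_of_cubic(4-7)[OF im]
  have "2 ^ (4 * i + 6 * j) * (mf_a (2 * \<tau>) ^ i * mf_b (2 * \<tau>) ^ j)
      = (16 * mf_a (2 * \<tau>)) ^ i * (64 * mf_b (2 * \<tau>)) ^ j"
    by (simp add: power_add power_mult power_mult_distrib)
  then show "eval_ab ([:[:1/2:]:] * trace (mpow (rho (level2 6 mf_b)) j ** mpow (rho (level2 4 mf_a)) i)) \<tau>
      = T2 (4 * i + 6 * j) (\<lambda>\<tau>. mf_a \<tau> ^ i * mf_b \<tau> ^ j) \<tau>"
    unfolding eval_ab_simps tr T2_def roots a_double[OF im] b_double[OF im]
    by (simp add: mult.commute)
qed

theorem theorem3p4:
  shows "F2 = half * trace (matrix_inv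
             ((mat 1 - mat vA ** emb_mat (rho (level2 4 mf_a)))
              ** (mat 1 - mat vB ** emb_mat (rho (level2 6 mf_b)))))
       \<and> half * trace (matrix_inv
             ((mat 1 - mat vA ** emb_mat (rho (level2 4 mf_a)))
              ** (mat 1 - mat vB ** emb_mat (rho (level2 6 mf_b)))))
         = half * trace (matrix_inv (M1 ** M2))"
proof
  show "F2 = half * trace (matrix_inv
             ((mat 1 - mat vA ** emb_mat (rho (level2 4 mf_a)))
              ** (mat 1 - mat vB ** emb_mat (rho (level2 6 mf_b)))))"
    by (intro fps_ext) (simp add: F2_def half_def emb_def inverse_product_coeff hecke_monomial)
qed (simp only: M1_eq M2_eq)

end
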